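(* Let $n,k\ge1$ and $g\ge0$, and let $\widehat r_{k,n}:B_{k,n}(\widehat\Sigma_g)\to B_{k,n}(\widehat\Sigma_g)/\Gamma_2(B_{k,n}(\widehat\Sigma_g))$ be the canonical projection. Let $\widehat S=\varnothing$ if $n=k=1$, $\widehat S=\{\sigma\}$ if $k\ge2$ and $n=1$, $\widehat S=\{\tilde\sigma\}$ if $k=1$ and $n\ge2$, $\widehat S=\{\sigma,\tilde\sigma\}$ if $k,n\ge2$; let $\widehat Z=\{\zeta\}$ if $g=0$ and $\widehat Z=\varnothing$ if $g\ge1$. Then $B_{k,n}(\widehat\Sigma_g)/\Gamma_2(B_{k,n}(\widehat\Sigma_g))$ admits the following presentation. Generating set: $\widehat r_{k,n}(S\cup\widetilde S\cup Z\cup AB\cup\widetilde{AB})=\widehat S\cup\widehat Z\cup AB\cup\widetilde{AB}$ (elements of $AB\cup\widetilde{AB}$ keeping their names). Relations: $xy=yx$ for all distinct $x,y\in\widehat S\cup\widehat Z\cup AB\cup\widetilde{AB}$; and, if $g\ge1$, $s^2=1$ for all $s\in\widehat S$. In particular, $\widehat r_{k,n}(S)=\{\sigma\}$ if $k\ge2$, $\widehat r_{k,n}(\widetilde S)=\{\tilde\sigma\}$ if $n\ge2$, $\widehat r_{k,n}(Z)=\{\zeta\}$ if $g=0$, and $B_{k,n}(\widehat\Sigma_g)/\Gamma_2(B_{k,n}(\widehat\Sigma_g))$ is isomorphic to $\mathbb Z^{|\widehat S|+1}$ if $g=0$ and to $\mathbb Z^{4g}\times\mathbb Z_2^{|\widehat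 S|}$ if $g\ge1$.
   Context: For a connected surface $\Sigma$, $\mathbb F_m(\Sigma)=\{(x_1,\dots,x_m)\in\Sigma^m: x_i\neq x_j\ (i\ne j)\}$ and $B_{k,n}(\Sigma)=\pi_1(\mathbb F_{k+n}(\Sigma)/(S_k\times S_n))$. $\widehat\Sigma_g$ is a compact connected orientable surface of genus $g$ with one boundary component. $\Gamma_2(G)=[G,G]$; $[x,y]=xyx^{-1}y^{-1}$, $x^y=y^{-1}xy$; $\mathbb Z_2=\mathbb Z/2\mathbb Z$. Presentation of $B_{k,n}(\widehat\Sigma_g)$. Generators: $S=\{\sigma_1,\dots,\sigma_{k-1}\}$, $\widetilde S=\{\tilde\sigma_1,\dots,\tilde\sigma_{n-1}\}$, $AB=\{a_1,b_1,\dots,a_g,b_g\}$, $\widetilde{AB}=\{\tilde a_1,\tilde b_1,\dots,\tilde a_g,\tilde b_g\}$, $Z=\{\zeta_1,\dots,\zeta_n\}$ ($S=\varnothing$ if $k=1$, $\widetilde S=\varnothing$ if $n=1$, $AB=\widetilde{AB}=\varnothing$ if $g=0$; relations involving absent letters are suppressed). Write $c<d$ for $c\in\{a_i,b_i\}$, $d\in\{a_j,b_j\}$, $i<j$. Relations (for all indices for which they make sense): (a) $\sigma_i\sigma_j=\sigma_j\sigma_i$ for $|i-j|\ge2$; $\sigma_i\sigma_{i+1}\sigma_i=\sigma_{i+1}\sigma_i\sigma_{i+1}$; $c\sigma_i=\sigma_ic$ for $i\neq1$, $c\in AB\cup Z$; $c\sigma_1c\sigma_1=\sigma_1c\sigma_1c$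 for $c\in AB\cup Z$; $a_i\sigma_1b_i=\sigma_1b_i\sigma_1a_i\sigma_1$; $\sigma_1^{-1}c\sigma_1$ commutes with $d$ for $c,d\in AB$, $c<d$; $\sigma_1^{-1}\zeta_i\sigma_1$ commutes with every $c\in AB$, and with $\zeta_j$ for $i<j$. (b) The relations of (a) among $S\cup AB$ only, with $k$ replaced by $n$ and $\sigma_i,a_i,b_i$ by $\tilde\sigma_i,\tilde a_i,\tilde b_i$. (c) $\tilde\sigma_i,\tilde a_i,\tilde b_i$ commute with every $\sigma_j$; $\tilde\sigma_i$ commutes with $a_j,b_j$; $\tilde\sigma_i\zeta_{i+1}\tilde\sigma_i^{-1}=\zeta_i$; $\tilde\sigma_i\zeta_i\tilde\sigma_i^{-1}=\zeta_i^{-1}\zeta_{i+1}\zeta_i$; $\tilde\sigma_i\zeta_j\tilde\sigma_i^{-1}=\zeta_j$ for $j\ne i,i+1$; for $(\tilde x,x)=(\tilde a_i,a_i)$ or $(\tilde b_i,b_i)$: $\tilde x\zeta_1\tilde x^{-1}=\zeta_1^{x\zeta_1}$, $\tilde x\zeta_j\tilde x^{-1}=\zeta_j^{[x^{-1},\zeta_1^{-1}]}$ for $j\ne1$, $\tilde xx\tilde x^{-1}=\zeta_1^{-1}x\zeta_1$, and for $d\in\{a_j,b_j\}$, $\tilde xd\tilde x^{-1}=d^{[x^{-1},\zeta_1^{-1}]}$ if $i>j$, $\tilde xd\tilde x^{-1}=d$ if $j>i$; $\tilde a_ib_i\tilde a_i^{-1}=b_i\zeta_1$; $\tilde b_ia_i\tilde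 b_i^{-1}=\zeta_1^{-1}a_i[b_i^{-1},\zeta_1^{-1}]$. The displayed equality of generating sets is to be read up to the identity element (which may be discarded from a generating set). *)

theory Defs
  imports "HOL-Analysis.Analysis" "HOL-Algebra.Generated_Groups"
    "HOL-Algebra.Product_Groups"
begin

section \<open>Quotient spaces\<close>

definition quotient_topology :: "'a topology \<Rightarrow> ('a \<times> 'a) set \<Rightarrow> 'a set topology" where
  "quotient_topology X r = topology (\<lambda>U. U \<subseteq> topspace X // r \<and> openin X (\<Union>U))"

lemma openin_quotient_topology:
  assumes "equiv (topspace X) r"
  shows "openin (quotient_topology X r) U \<longleftrightarrow> U \<subseteq> topspace X // r \<and> openin X (\<Union>U)"
proof -
  have "\<Union>(U \<inter> V) = \<Union>U \<inter> \<Union>V" if "U \<subseteq> topspace X // r" "V \<subseteq> topspace X // r" for U V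
    using that quotient_disj[OF assms] by blast
  moreover have "openin X (\<Union>(\<Union>K))" if "\<forall>U\<in>K. openin X (\<Union>U)" for K
  proof -
    have "\<Union>(\<Union>K) = \<Union>(Union ` K)"
      by blast
    with that show ?thesis
      by (metis (no_types, lifting) imageE openin_Union)
  qed
  ultimately have "istopology (\<lambda>U. U \<subseteq> topspace X // r \<and> openin X (\<Union>U))"
    unfolding istopology_def by (auto simp: le_infI1)
  then show ?thesis
    by (simp add: quotient_topology_def topology_inverse')
qed


section \<open>The fundamental group\<close>

definition loops :: "'a topology \<Rightarrow> 'a \<Rightarrow> (real \<Rightarrow> 'a) set" where
  "loops X x0 = {p. pathin X p \<and> p 0 = x0 \<and> p 1 = x0}"

definition loop_homotopic :: "'a topology \<Rightarrow> 'a \<Rightarrow> (real \<Rightarrow> 'a) \<Rightarrow> (real \<Rightarrow> 'a) \<Rightarrow> bool" where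
  "loop_homotopic X x0 p q \<longleftrightarrow>
     homotopic_with (\<lambda>h. h 0 = x0 \<and> h 1 = x0) (top_of_set {0..1}) X p q"

definition loop_class :: "'a topology \<Rightarrow> 'a \<Rightarrow> (real \<Rightarrow> 'a) \<Rightarrow> (real \<Rightarrow> 'a) set" where
  "loop_class X x0 p = {q \<in> loops X x0. loop_homotopic X x0 p q}"

text \<open>The library's \<open>joinpaths\<close> requires a \<open>topological_space\<close> type, which a configuration
  space does not have.\<close>

definition loop_concat :: "(real \<Rightarrow> 'a) \<Rightarrow> (real \<Rightarrow> 'a) \<Rightarrow> real \<Rightarrow> 'a" where
  "loop_concat p q = (\<lambda>t. if t \<le> 1/2 then p (2 * t) else q (2 * t - 1))"

definition fundamental_group :: "'a topology \<Rightarrow> 'a \<Rightarrow> (real \<Rightarrow> 'a) set monoid" where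
  "fundamental_group X x0 =
     \<lparr>carrier = loop_class X x0 ` loops X x0,
      monoid.mult = (\<lambda>C D. \<Union>p\<in>C. \<Union>q\<in>D. loop_class X x0 (loop_concat p q)),
      one = loop_class X x0 (\<lambda>_. x0)\<rparr>"


section \<open>The surface of genus g with one boundary component\<close>

text \<open>The closed unit disc is regarded as a polygon with \<open>4g + 1\<close> sides carrying the boundary word
  \<open>x\<^sub>1 y\<^sub>1 x\<^sub>1\<inverse> y\<^sub>1\<inverse> \<dots> x\<^sub>g y\<^sub>g x\<^sub>g\<inverse> y\<^sub>g\<inverse> c\<close>. Sides with the same letter are glued; the side \<open>c\<close>
  stays free and becomes the boundary circle (all vertices are identified). For \<open>g = 0\<close> nothing
  is glued and the surface is the disc.\<close>

definition polygon_side :: "nat \<Rightarrow> nat \<Rightarrow> real \<Rightarrow> complex" where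
  "polygon_side g j t = cis (2 * pi * (real j + t) / real (4 * g + 1))"

definition polygon_gluing :: "nat \<Rightarrow> (complex \<times> complex) set" where
  "polygon_gluing g =
     (\<Union>i<g. \<Union>t\<in>{0..1}.
        {(polygon_side g (4*i) t,     polygon_side g (4*i + 2) (1 - t)),
         (polygon_side g (4*i + 1) t, polygon_side g (4*i + 3) (1 - t))})"

definition polygon_equiv :: "nat \<Rightarrow> (complex \<times> complex) set" where
  "polygon_equiv g =
     (polygon_gluing g \<union> (polygon_gluing g)\<inverse>)\<^sup>* \<inter> cball 0 1 \<times> cball 0 1"

lemma equiv_polygon_equiv: "equiv (cball 0 1) (polygon_equiv g)"
proof (rule equivI)
  have "sym ((polygon_gluing g \<union> (polygon_gluing g)\<inverse>)\<^sup>*)"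
    by (intro sym_rtrancl) (auto simp: sym_def)
  then show "sym (polygon_equiv g)"
    by (auto simp: polygon_equiv_def sym_def)
  show "trans (polygon_equiv g)"
    unfolding polygon_equiv_def trans_def by (blast intro: rtrancl_trans)
qed (auto simp: polygon_equiv_def refl_on_def)

definition surface_model :: "nat \<Rightarrow> complex set topology" where
  "surface_model g = quotient_topology (top_of_set (cball 0 1)) (polygon_equiv g)"

text \<open>By the classification of surfaces, these are the compact connected orientable surfaces of
  genus \<open>g\<close> with one boundary component.\<close>

definition one_holed_surface :: "nat \<Rightarrow> 'a topology \<Rightarrow> bool" where
  "one_holed_surface g \<Sigma> \<longleftrightarrow> \<Sigma> homeomorphic_space surface_model g"


section \<open>Mixed braid groups\<close>

text \<open>The strands are numbered from 0: those below \<open>k\<close> are permuted by \<open>S\<^sub>k\<close> and the others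
  by \<open>S\<^sub>n\<close>.\<close>

definition config_space :: "'a topology \<Rightarrow> nat \<Rightarrow> (nat \<Rightarrow> 'a) topology" where
  "config_space \<Sigma> m =
     subtopology (product_topology (\<lambda>_. \<Sigma>) {..<m}) {x. inj_on x {..<m}}"

definition mixed_orbit_rel :: "'a topology \<Rightarrow> nat \<Rightarrow> nat \<Rightarrow> ((nat \<Rightarrow> 'a) \<times> (nat \<Rightarrow> 'a)) set" where
  "mixed_orbit_rel \<Sigma> k n =
     {(x, y). x \<in> topspace (config_space \<Sigma> (k + n)) \<and>
        (\<exists>p q. p permutes {..<k} \<and> q permutes {k..<k + n} \<and> y = x \<circ> (p \<circ> q))}"

lemma equiv_mixed_orbit_rel:
  "equiv (topspace (config_space \<Sigma> (k + n))) (mixed_orbit_rel \<Sigma> k n)"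
proof (rule equivI)
  let ?T = "topspace (config_space \<Sigma> (k + n))"
  have pq: "p \<circ> q permutes {..<k + n}"
    if "p permutes {..<k}" "q permutes {k..<k + n}" for p q
    using that by (meson permutes_compose permutes_subset lessThan_subset_iff le_add1
        atLeastLessThan_upt subset_iff atLeastLessThan_iff lessThan_iff)
  have comm: "q \<circ> p = p \<circ> q"
    if p: "p permutes {..<k}" and q: "q permutes {k..<k + n}" for p q
  proof
    fix i
    show "(q \<circ> p) i = (p \<circ> q) i"
    proof (cases "i < k")
      case True
      then have "p i < k" using permutes_in_image[OF p, of i] by simp
      with True show ?thesis using permutes_not_in[OF q] by simp
    next
      case False
      then have "\<not> q i < k"
        using permutes_in_image[OF q, of i] permutes_not_in[OF q, of i] by force
      with False show ?thesis using permutes_not_in[OF p] by simp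
    qed
  qed
  have T: "x \<circ> s \<in> ?T" if x: "x \<in> ?T" and s: "s permutes {..<k + n}" for x s
  proof -
    have "s i = i" if "i \<notin> {..<k + n}" for i using permutes_not_in[OF s that] .
    moreover have "s i \<in> {..<k + n}" if "i \<in> {..<k + n}" for i
      using permutes_in_image[OF s] that by blast
    ultimately have "x \<circ> s \<in> {..<k + n} \<rightarrow>\<^sub>E topspace \<Sigma>"
      using x by (auto simp: config_space_def PiE_iff extensional_def)
    moreover have "inj_on (x \<circ> s) {..<k + n}"
      using x s by (intro comp_inj_on)
        (auto simp: config_space_def permutes_inj_on permutes_image)
    ultimately show ?thesis
      by (simp add: config_space_def)
  qed
  show "mixed_orbit_rel \<Sigma> k n \<subseteq> ?T \<times> ?T"
    unfolding mixed_orbit_rel_def using T pq by blast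
  show "refl_on ?T (mixed_orbit_rel \<Sigma> k n)"
    unfolding refl_on_def mixed_orbit_rel_def using permutes_id by fastforce
  show "sym (mixed_orbit_rel \<Sigma> k n)"
  proof (rule symI)
    fix x y assume "(x, y) \<in> mixed_orbit_rel \<Sigma> k n"
    then obtain p q where x: "x \<in> ?T" and p: "p permutes {..<k}"
      and q: "q permutes {k..<k + n}" and y: "y = x \<circ> (p \<circ> q)"
      unfolding mixed_orbit_rel_def by blast
    have "(p \<circ> q) \<circ> (inv_into UNIV p \<circ> inv_into UNIV q) = (q \<circ> p) \<circ> (inv_into UNIV p \<circ> inv_into UNIV q)"
      by (simp add: comm[OF p q])
    also have "\<dots> = id"
      using permutes_inv_o(1)[OF p] permutes_inv_o(1)[OF q] by (metis comp_assoc comp_id)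
    finally have "x = y \<circ> (inv_into UNIV p \<circ> inv_into UNIV q)"
      by (metis y comp_assoc comp_id)
    moreover have "y \<in> ?T"
      using y T[OF x pq[OF p q]] by simp
    ultimately show "(y, x) \<in> mixed_orbit_rel \<Sigma> k n"
      unfolding mixed_orbit_rel_def using permutes_inv[OF p] permutes_inv[OF q] by blast
  qed
  show "trans (mixed_orbit_rel \<Sigma> k n)"
  proof (rule transI)
    fix x y z
    assume "(x, y) \<in> mixed_orbit_rel \<Sigma> k n" "(y, z) \<in> mixed_orbit_rel \<Sigma> k n"
    then obtain p q p' q' where x: "x \<in> ?T"
      and p: "p permutes {..<k}" "p' permutes {..<k}"
      and q: "q permutes {k..<k + n}" "q' permutes {k..<k + n}"
      and "z = x \<circ> (p \<circ> q) \<circ> (p' \<circ> q')"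
      unfolding mixed_orbit_rel_def by blast
    then have "z = x \<circ> ((p \<circ> p') \<circ> (q \<circ> q'))"
      using comm[OF p(2) q(1)] by (metis comp_assoc)
    then show "(x, z) \<in> mixed_orbit_rel \<Sigma> k n"
      unfolding mixed_orbit_rel_def
      using x permutes_compose[OF p(2,1)] permutes_compose[OF q(2,1)] by blast
  qed
qed

definition mixed_config_space :: "'a topology \<Rightarrow> nat \<Rightarrow> nat \<Rightarrow> (nat \<Rightarrow> 'a) set topology" where
  "mixed_config_space \<Sigma> k n =
     quotient_topology (config_space \<Sigma> (k + n)) (mixed_orbit_rel \<Sigma> k n)"

definition mixed_braid_group ::
  "'a topology \<Rightarrow> nat \<Rightarrow> nat \<Rightarrow> (nat \<Rightarrow> 'a) set \<Rightarrow> (real \<Rightarrow> (nat \<Rightarrow> 'a) set) set monoid" where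
  "mixed_braid_group \<Sigma> k n x0 = fundamental_group (mixed_config_space \<Sigma> k n) x0"


section \<open>Group presentations\<close>

text \<open>The pair \<open>(x, True)\<close> stands for the letter \<open>x\<close>, and \<open>(x, False)\<close> for its inverse.\<close>

type_synonym 'x word = "('x \<times> bool) list"

definition words :: "'x set \<Rightarrow> 'x word set" where
  "words X = lists (X \<times> UNIV)"

definition letter :: "'x \<Rightarrow> 'x word" where
  "letter x = [(x, True)]"

definition winv :: "'x word \<Rightarrow> 'x word" where
  "winv u = rev (map (\<lambda>(x, e). (x, \<not> e)) u)"

definition wcomm :: "'x word \<Rightarrow> 'x word \<Rightarrow> 'x word" where
  "wcomm u v = u @ v @ winv u @ winv v"

definition wconj :: "'x word \<Rightarrow> 'x word \<Rightarrow> 'x word" where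
  "wconj u v = winv v @ u @ v"

primrec word_eval :: "('a, 'b) monoid_scheme \<Rightarrow> ('x \<Rightarrow> 'a) \<Rightarrow> 'x word \<Rightarrow> 'a" where
  "word_eval G f [] = \<one>\<^bsub>G\<^esub>"
| "word_eval G f (l # u) =
     (if snd l then f (fst l) else inv\<^bsub>G\<^esub> f (fst l)) \<otimes>\<^bsub>G\<^esub> word_eval G f u"

text \<open>Equality of words over \<open>X\<close> in the group presented by \<open>\<langle>X | R\<rangle>\<close>, where \<open>(l, r) \<in> R\<close> encodes
  the relation \<open>l = r\<close>.\<close>

inductive pres_eq :: "'x set \<Rightarrow> ('x word \<times> 'x word) set \<Rightarrow> 'x word \<Rightarrow> 'x word \<Rightarrow> bool"
  for X R where
  refl: "u \<in> words X \<Longrightarrow> pres_eq X R u u"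
| sym: "pres_eq X R u v \<Longrightarrow> pres_eq X R v u"
| trans: "pres_eq X R u v \<Longrightarrow> pres_eq X R v w \<Longrightarrow> pres_eq X R u w"
| cancel: "u \<in> words X \<Longrightarrow> v \<in> words X \<Longrightarrow> x \<in> X \<Longrightarrow>
    pres_eq X R (u @ [(x, e), (x, \<not> e)] @ v) (u @ v)"
| rel: "u \<in> words X \<Longrightarrow> v \<in> words X \<Longrightarrow> (l, r) \<in> R \<Longrightarrow>
    pres_eq X R (u @ l @ v) (u @ r @ v)"

text \<open>\<open>G\<close> is presented by \<open>\<langle>X | R\<rangle>\<close>, the letter \<open>x\<close> denoting the element \<open>f x\<close>: the induced
  homomorphism from the free group on \<open>X\<close> to \<open>G\<close> is onto, and its kernel is the normal closure
  of the relators.\<close>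

definition has_presentation ::
  "('a, 'b) monoid_scheme \<Rightarrow> 'x set \<Rightarrow> ('x word \<times> 'x word) set \<Rightarrow> ('x \<Rightarrow> 'a) \<Rightarrow> bool" where
  "has_presentation G X R f \<longleftrightarrow>
     group G \<and> f ` X \<subseteq> carrier G \<and> R \<subseteq> words X \<times> words X \<and>
     word_eval G f ` words X = carrier G \<and>
     (\<forall>u\<in>words X. \<forall>v\<in>words X. word_eval G f u = word_eval G f v \<longleftrightarrow> pres_eq X R u v)"


section \<open>The presentation of the mixed braid group\<close>

text \<open>The constructors stand for \<open>\<sigma>\<^sub>i\<close>, \<open>\<sigma>\<^sub>i\<close> with tilde, \<open>a\<^sub>i\<close>, \<open>b\<^sub>i\<close>, \<open>a\<^sub>i\<close> with tilde, \<open>b\<^sub>i\<close> with tilde, and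
  \<open>\<zeta>\<^sub>i\<close>. The final \<open>t\<close> of a name always means a tilde.\<close>

datatype braid_letter =
  LSigma nat | LSigmat nat | LA nat | LB nat | LAt nat | LBt nat | LZeta nat

definition S_letters :: "nat \<Rightarrow> braid_letter set" where
  "S_letters k = LSigma ` {1..<k}"

definition St_letters :: "nat \<Rightarrow> braid_letter set" where
  "St_letters n = LSigmat ` {1..<n}"

definition AB_letters :: "nat \<Rightarrow> braid_letter set" where
  "AB_letters g = LA ` {1..g} \<union> LB ` {1..g}"

definition ABt_letters :: "nat \<Rightarrow> braid_letter set" where
  "ABt_letters g = LAt ` {1..g} \<union> LBt ` {1..g}"

definition Z_letters :: "nat \<Rightarrow> braid_letter set" where
  "Z_letters n = LZeta ` {1..n}"

definition braid_gens :: "nat \<Rightarrow> nat \<Rightarrow> nat \<Rightarrow> braid_letter set" where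
  "braid_gens k n g =
     S_letters k \<union> St_letters n \<union> Z_letters n \<union> AB_letters g \<union> ABt_letters g"

text \<open>The relations of the braid group on \<open>m\<close> strands of the surface. They occur twice below: for the
  first \<open>k\<close> strands with the plain letters and for the last \<open>n\<close> strands with the tilde letters.\<close>

inductive_set surface_braid_rels ::
  "nat \<Rightarrow> nat \<Rightarrow> (nat \<Rightarrow> 'x word) \<Rightarrow> (nat \<Rightarrow> 'x word) \<Rightarrow> (nat \<Rightarrow> 'x word) \<Rightarrow> ('x word \<times> 'x word) set"
  for m g :: nat and s a b :: "nat \<Rightarrow> 'x word" where
  far: "i \<in> {1..<m} \<Longrightarrow> j \<in> {1..<m} \<Longrightarrow> i + 2 \<le> j \<or> j + 2 \<le> i \<Longrightarrow>
    (s i @ s j, s j @ s i) \<in> surface_braid_rels m g s a b"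
| braid: "i \<in> {1..<m} \<Longrightarrow> i + 1 \<in> {1..<m} \<Longrightarrow>
    (s i @ s (i + 1) @ s i, s (i + 1) @ s i @ s (i + 1)) \<in> surface_braid_rels m g s a b"
| handle_far: "i \<in> {1..<m} \<Longrightarrow> i \<noteq> 1 \<Longrightarrow> h \<in> {1..g} \<Longrightarrow> c \<in> {a h, b h} \<Longrightarrow>
    (c @ s i, s i @ c) \<in> surface_braid_rels m g s a b"
| handle_near: "1 \<in> {1..<m} \<Longrightarrow> h \<in> {1..g} \<Longrightarrow> c \<in> {a h, b h} \<Longrightarrow>
    (c @ s 1 @ c @ s 1, s 1 @ c @ s 1 @ c) \<in> surface_braid_rels m g s a b"
| handle_pair: "1 \<in> {1..<m} \<Longrightarrow> h \<in> {1..g} \<Longrightarrow>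
    (a h @ s 1 @ b h, s 1 @ b h @ s 1 @ a h @ s 1) \<in> surface_braid_rels m g s a b"
| handle_less: "1 \<in> {1..<m} \<Longrightarrow> h \<in> {1..g} \<Longrightarrow> h' \<in> {1..g} \<Longrightarrow> h < h' \<Longrightarrow>
    c \<in> {a h, b h} \<Longrightarrow> d \<in> {a h', b h'} \<Longrightarrow>
    (winv (s 1) @ c @ s 1 @ d, d @ winv (s 1) @ c @ s 1) \<in> surface_braid_rels m g s a b"

abbreviation "sg i \<equiv> letter (LSigma i)"
abbreviation "sgt i \<equiv> letter (LSigmat i)"
abbreviation "ha i \<equiv> letter (LA i)"
abbreviation "hb i \<equiv> letter (LB i)"
abbreviation "hat i \<equiv> letter (LAt i)"
abbreviation "hbt i \<equiv> letter (LBt i)"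
abbreviation "ze i \<equiv> letter (LZeta i)"

inductive_set zeta_rels :: "nat \<Rightarrow> nat \<Rightarrow> nat \<Rightarrow> (braid_letter word \<times> braid_letter word) set"
  for k n g :: nat where
  zeta_far: "i \<in> {1..<k} \<Longrightarrow> i \<noteq> 1 \<Longrightarrow> j \<in> {1..n} \<Longrightarrow>
    (ze j @ sg i, sg i @ ze j) \<in> zeta_rels k n g"
| zeta_near: "1 \<in> {1..<k} \<Longrightarrow> j \<in> {1..n} \<Longrightarrow>
    (ze j @ sg 1 @ ze j @ sg 1, sg 1 @ ze j @ sg 1 @ ze j) \<in> zeta_rels k n g"
| zeta_handle: "1 \<in> {1..<k} \<Longrightarrow> i \<in> {1..n} \<Longrightarrow> h \<in> {1..g} \<Longrightarrow> c \<in> {ha h, hb h} \<Longrightarrow>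
    (winv (sg 1) @ ze i @ sg 1 @ c, c @ winv (sg 1) @ ze i @ sg 1) \<in> zeta_rels k n g"
| zeta_less: "1 \<in> {1..<k} \<Longrightarrow> i \<in> {1..n} \<Longrightarrow> j \<in> {1..n} \<Longrightarrow> i < j \<Longrightarrow>
    (winv (sg 1) @ ze i @ sg 1 @ ze j, ze j @ winv (sg 1) @ ze i @ sg 1) \<in> zeta_rels k n g"

text \<open>The relations describing conjugation of the plain letters by the tilde letters.\<close>

inductive_set action_rels :: "nat \<Rightarrow> nat \<Rightarrow> nat \<Rightarrow> (braid_letter word \<times> braid_letter word) set"
  for k n g :: nat where
  sigmat_sigma: "i \<in> {1..<n} \<Longrightarrow> j \<in> {1..<k} \<Longrightarrow>
    (sgt i @ sg j, sg j @ sgt i) \<in> action_rels k n g"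
| handle_sigma: "h \<in> {1..g} \<Longrightarrow> c \<in> {hat h, hbt h} \<Longrightarrow> j \<in> {1..<k} \<Longrightarrow>
    (c @ sg j, sg j @ c) \<in> action_rels k n g"
| sigmat_handle: "i \<in> {1..<n} \<Longrightarrow> h \<in> {1..g} \<Longrightarrow> c \<in> {ha h, hb h} \<Longrightarrow>
    (sgt i @ c, c @ sgt i) \<in> action_rels k n g"
| sigmat_zeta_Suc: "i \<in> {1..<n} \<Longrightarrow>
    (sgt i @ ze (i + 1) @ winv (sgt i), ze i) \<in> action_rels k n g"
| sigmat_zeta: "i \<in> {1..<n} \<Longrightarrow>
    (sgt i @ ze i @ winv (sgt i), winv (ze i) @ ze (i + 1) @ ze i) \<in> action_rels k n g"
| sigmat_zeta_other: "i \<in> {1..<n} \<Longrightarrow> j \<in> {1..n} \<Longrightarrow> j \<noteq> i \<Longrightarrow> j \<noteq> i + 1 \<Longrightarrow>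
    (sgt i @ ze j @ winv (sgt i), ze j) \<in> action_rels k n g"
| handle_zeta_1: "1 \<in> {1..n} \<Longrightarrow> h \<in> {1..g} \<Longrightarrow> (xt, x) \<in> {(hat h, ha h), (hbt h, hb h)} \<Longrightarrow>
    (xt @ ze 1 @ winv xt, wconj (ze 1) (x @ ze 1)) \<in> action_rels k n g"
| handle_zeta: "j \<in> {1..n} \<Longrightarrow> j \<noteq> 1 \<Longrightarrow> h \<in> {1..g} \<Longrightarrow>
    (xt, x) \<in> {(hat h, ha h), (hbt h, hb h)} \<Longrightarrow>
    (xt @ ze j @ winv xt, wconj (ze j) (wcomm (winv x) (winv (ze 1)))) \<in> action_rels k n g"
| handle_same: "1 \<in> {1..n} \<Longrightarrow> h \<in> {1..g} \<Longrightarrow> (xt, x) \<in> {(hat h, ha h), (hbt h, hb h)} \<Longrightarrow>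
    (xt @ x @ winv xt, winv (ze 1) @ x @ ze 1) \<in> action_rels k n g"
| handle_greater: "1 \<in> {1..n} \<Longrightarrow> h \<in> {1..g} \<Longrightarrow> j \<in> {1..g} \<Longrightarrow> h > j \<Longrightarrow>
    (xt, x) \<in> {(hat h, ha h), (hbt h, hb h)} \<Longrightarrow> d \<in> {ha j, hb j} \<Longrightarrow>
    (xt @ d @ winv xt, wconj d (wcomm (winv x) (winv (ze 1)))) \<in> action_rels k n g"
| handle_less: "h \<in> {1..g} \<Longrightarrow> j \<in> {1..g} \<Longrightarrow> j > h \<Longrightarrow>
    (xt, x) \<in> {(hat h, ha h), (hbt h, hb h)} \<Longrightarrow> d \<in> {ha j, hb j} \<Longrightarrow>
    (xt @ d @ winv xt, d) \<in> action_rels k n g"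
| at_b: "1 \<in> {1..n} \<Longrightarrow> h \<in> {1..g} \<Longrightarrow>
    (hat h @ hb h @ winv (hat h), hb h @ ze 1) \<in> action_rels k n g"
| bt_a: "1 \<in> {1..n} \<Longrightarrow> h \<in> {1..g} \<Longrightarrow>
    (hbt h @ ha h @ winv (hbt h), winv (ze 1) @ ha h @ wcomm (winv (hb h)) (winv (ze 1)))
      \<in> action_rels k n g"

definition braid_rels :: "nat \<Rightarrow> nat \<Rightarrow> nat \<Rightarrow> (braid_letter word \<times> braid_letter word) set" where
  "braid_rels k n g =
     surface_braid_rels k g sg ha hb \<union> zeta_rels k n g \<union>
     surface_braid_rels n g sgt hat hbt \<union> action_rels k n g"

lemma braid_rels_words:
  "braid_rels k n g \<subseteq> words (braid_gens k n g) \<times> words (braid_gens k n g)"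
proof -
  let ?W = "words (braid_gens k n g)"
  have app: "u @ v \<in> ?W \<longleftrightarrow> u \<in> ?W \<and> v \<in> ?W" for u v
    by (auto simp: words_def)
  have winv: "winv u \<in> ?W \<longleftrightarrow> u \<in> ?W" for u
    by (auto simp: words_def winv_def in_lists_conv_set)
  have ltr: "letter x \<in> ?W \<longleftrightarrow> x \<in> braid_gens k n g" for x
    by (simp add: words_def letter_def)
  have gens:
    "LSigma i \<in> braid_gens k n g \<longleftrightarrow> i \<in> {1..<k}" "LSigmat i \<in> braid_gens k n g \<longleftrightarrow> i \<in> {1..<n}"
    "LZeta i \<in> braid_gens k n g \<longleftrightarrow> i \<in> {1..n}"
    "LA i \<in> braid_gens k n g \<longleftrightarrow> i \<in> {1..g}" "LB i \<in> braid_gens k n g \<longleftrightarrow> i \<in> {1..g}"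
    "LAt i \<in> braid_gens k n g \<longleftrightarrow> i \<in> {1..g}" "LBt i \<in> braid_gens k n g \<longleftrightarrow> i \<in> {1..g}" for i
    by (auto simp: braid_gens_def S_letters_def St_letters_def Z_letters_def AB_letters_def
        ABt_letters_def)
  note simps = app winv ltr wcomm_def wconj_def gens
  have "surface_braid_rels k g sg ha hb \<subseteq> ?W \<times> ?W"
    by (rule subrelI, erule surface_braid_rels.cases) (auto simp: simps)
  moreover have "surface_braid_rels n g sgt hat hbt \<subseteq> ?W \<times> ?W"
    by (rule subrelI, erule surface_braid_rels.cases) (auto simp: simps)
  moreover have "zeta_rels k n g \<subseteq> ?W \<times> ?W"
    by (rule subrelI, erule zeta_rels.cases) (auto simp: simps)
  moreover have "action_rels k n g \<subseteq> ?W \<times> ?W"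
    by (rule subrelI, erule action_rels.cases) (auto simp: simps)
  ultimately show ?thesis
    by (simp add: braid_rels_def)
qed


section \<open>The abelianisation\<close>

definition Gamma2 :: "('a, 'b) monoid_scheme \<Rightarrow> 'a set" where
  "Gamma2 G = derived G (carrier G)"

definition Gamma2_proj :: "('a, 'b) monoid_scheme \<Rightarrow> 'a \<Rightarrow> 'a set" where
  "Gamma2_proj G x = Gamma2 G #>\<^bsub>G\<^esub> x"

datatype ab_letter = QSigma | QSigmat | QZeta | QA nat | QB nat | QAt nat | QBt nat

text \<open>As above, without indices on the classes \<open>\<sigma>\<close>, \<open>\<sigma>\<close> with tilde and \<open>\<zeta>\<close>; \<open>Shat\<close> and \<open>Zhat\<close> are
  the sets of those classes that are needed.\<close>

definition Shat :: "nat \<Rightarrow> nat \<Rightarrow> ab_letter set" where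
  "Shat k n = (if k \<ge> 2 then {QSigma} else {}) \<union> (if n \<ge> 2 then {QSigmat} else {})"

definition Zhat :: "nat \<Rightarrow> ab_letter set" where
  "Zhat g = (if g = 0 then {QZeta} else {})"

definition ab_gens :: "nat \<Rightarrow> nat \<Rightarrow> nat \<Rightarrow> ab_letter set" where
  "ab_gens k n g =
     Shat k n \<union> Zhat g \<union> QA ` {1..g} \<union> QB ` {1..g} \<union> QAt ` {1..g} \<union> QBt ` {1..g}"

definition ab_rels :: "nat \<Rightarrow> nat \<Rightarrow> nat \<Rightarrow> (ab_letter word \<times> ab_letter word) set" where
  "ab_rels k n g =
     {(letter x @ letter y, letter y @ letter x) | x y.
        x \<in> ab_gens k n g \<and> y \<in> ab_gens k n g \<and> x \<noteq> y} \<union>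
     (if g \<ge> 1 then {(letter s @ letter s, []) | s. s \<in> Shat k n} else {})"

definition Z_power :: "nat \<Rightarrow> (nat \<Rightarrow> int) monoid" where
  "Z_power m = product_group {..<m} (\<lambda>_. integer_group)"

definition Z2_power :: "nat \<Rightarrow> (nat \<Rightarrow> int) monoid" where
  "Z2_power m = product_group {..<m} (\<lambda>_. integer_mod_group 2)"

end

theory Submission
  imports Defs
begin

text \<open>Only the presentation of the braid group matters. Its relations, read in an abelian group,
  identify the letters of each family \<open>\<sigma>\<^sub>i\<close>, \<open>\<zeta>\<^sub>i\<close> (and of the tilde family), and for \<open>g \<ge> 1\<close> they kill
  \<open>\<zeta>\<^sub>1\<close> and make the \<open>\<sigma>\<close>s involutions. Conversely, for every remaining generator the exponent sum of a
  word, taken modulo 2 for these involutions, respects all relations and vanishes on commutators, so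
  no further relation holds in the quotient. In a group with commuting generators a word all of whose
  exponent sums vanish in this sense can be reduced to the empty word.\<close>

section \<open>Membership in the set of words over an alphabet\<close>

lemma Nil_in_words [simp]: "[] \<in> words X"
  by (simp add: words_def)

lemma Cons_in_words [simp]: "p # u \<in> words X \<longleftrightarrow> fst p \<in> X \<and> u \<in> words X"
  by (cases p) (auto simp: words_def)

lemma append_in_words [simp]: "u @ v \<in> words X \<longleftrightarrow> u \<in> words X \<and> v \<in> words X"
  by (induction u) auto

lemma winv_Nil [simp]: "winv [] = []"
  by (simp add: winv_def)

lemma winv_Cons [simp]: "winv (p # u) = winv u @ [(fst p, \<not> snd p)]"
  by (cases p) (simp add: winv_def)

lemma winv_in_words [simp]: "winv u \<in> words X \<longleftrightarrow> u \<in> words X"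
  by (induction u) auto

lemma letter_in_words [simp]: "letter x \<in> words X \<longleftrightarrow> x \<in> X"
  by (simp add: letter_def)


section \<open>Evaluation of words\<close>

context group
begin

lemma word_eval_closed:
  assumes "f ` X \<subseteq> carrier G" "u \<in> words X"
  shows "word_eval G f u \<in> carrier G"
  using assms(2) by (induction u) (use assms(1) in auto)

lemma word_eval_append:
  assumes "f ` X \<subseteq> carrier G" "u \<in> words X" "v \<in> words X"
  shows "word_eval G f (u @ v) = word_eval G f u \<otimes> word_eval G f v"
  using assms(2)
proof (induction u)
  case Nil
  then show ?case
    using word_eval_closed[OF assms(1,3)] by simp
next
  case (Cons p u)
  have "f (fst p) \<in> carrier G"
    using Cons.prems assms(1) by auto
  then show ?case
    using Cons word_eval_closed[OF assms(1)] assms(3) by (simp add: m_assoc)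
qed

lemma word_eval_letter [simp]: "f x \<in> carrier G \<Longrightarrow> word_eval G f (letter x) = f x"
  by (simp add: letter_def)

lemma word_eval_winv:
  assumes "f ` X \<subseteq> carrier G" "u \<in> words X"
  shows "word_eval G f (winv u) = inv word_eval G f u"
  using assms(2)
proof (induction u)
  case (Cons p u)
  have p: "f (fst p) \<in> carrier G"
    using Cons.prems assms(1) by auto
  then show ?case
    using Cons word_eval_closed[OF assms(1)]
    by (subst winv_Cons, subst word_eval_append[OF assms(1)]) (auto simp: inv_mult_group)
qed simp

text \<open>Von Dyck's argument: an assignment of letters that satisfies the defining relations
  respects every elementary move, hence descends to the presented group.\<close>

lemma word_eval_cong_pres_eq:
  assumes f: "f ` X \<subseteq> carrier G" and R: "R \<subseteq> words X \<times> words X"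
    and rels: "\<And>l r. (l, r) \<in> R \<Longrightarrow> word_eval G f l = word_eval G f r"
    and "pres_eq X R u v"
  shows "word_eval G f u = word_eval G f v"
  using assms(4)
proof induction
  case (cancel u v x e)
  have "f x \<in> carrier G"
    using cancel f by auto
  then have "word_eval G f ([(x, e), (x, \<not> e)] @ v) = word_eval G f v"
    using word_eval_closed[OF f cancel(2)] by (auto simp: m_assoc[symmetric])
  then show ?case
    using cancel by (simp del: append_Cons add: word_eval_append[OF f])
next
  case (rel u v l r)
  moreover have "l \<in> words X" "r \<in> words X"
    using rel R by auto
  ultimately show ?case
    using rels[OF rel(3)] by (simp add: word_eval_append[OF f])
qed auto

lemma word_eval_hom:
  assumes "group H" "h \<in> hom G H" "f ` X \<subseteq> carrier G" "u \<in> words X"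
  shows "word_eval H (h \<circ> f) u = h (word_eval G f u)"
proof -
  interpret h: group_hom G H h
    using assms(1,2) is_group by (simp add: group_hom_def group_hom_axioms_def)
  show ?thesis
    using assms(4)
  proof (induction u)
    case (Cons p u)
    then have "f (fst p) \<in> carrier G" "word_eval G f u \<in> carrier G"
      using assms(3) word_eval_closed[OF assms(3)] by auto
    then show ?case
      using Cons by auto
  qed simp
qed

end


section \<open>Weights of words\<close>

text \<open>The value at \<open>u\<close> of the homomorphism from the free group to the integers
  that extends \<open>F\<close>.\<close>

definition weight :: "('x \<Rightarrow> int) \<Rightarrow> 'x word \<Rightarrow> int" where
  "weight F u = (\<Sum>(x, e)\<leftarrow>u. if e then F x else - F x)"

lemma weight_simps [simp]:
  "weight F [] = 0"
  "weight F (p # u) = (if snd p then F (fst p) else - F (fst p)) + weight F u"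
  "weight F (u @ v) = weight F u + weight F v"
  by (auto simp: weight_def case_prod_beta)

lemma weight_letter [simp]: "weight F (letter x) = F x"
  by (simp add: letter_def)

lemma weight_winv [simp]: "weight F (winv u) = - weight F u"
  by (induction u) auto

lemma weight_wcomm [simp]: "weight F (wcomm u v) = 0"
  by (simp add: wcomm_def)

lemma weight_wconj [simp]: "weight F (wconj u v) = weight F u"
  by (simp add: wconj_def)

lemma weight_map: "weight F (map (map_prod h id) u) = weight (F \<circ> h) u"
  by (induction u) auto

abbreviation exponent_sum :: "'x \<Rightarrow> 'x word \<Rightarrow> int" where
  "exponent_sum x \<equiv> weight (\<lambda>y. of_bool (y = x))"

text \<open>Cancellation does not change the weight, and applying a relation changes it by a
  multiple of \<open>m\<close>. Since \<open>0 dvd z\<close> means \<open>z = 0\<close>, the choice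
  \<open>m = 0\<close> gives integer invariants and \<open>m = 2\<close> gives parities.\<close>

lemma weight_pres_eq:
  assumes "\<And>l r. (l, r) \<in> R \<Longrightarrow> m dvd weight F l - weight F r"
    and "pres_eq X R u v"
  shows "m dvd weight F u - weight F v"
  using assms(2)
proof induction
  case (sym u v)
  then show ?case by (simp add: dvd_diff_commute)
next
  case (trans u v w)
  show ?case using dvd_add[OF trans.IH] by simp
next
  case (rel u v l r)
  then show ?case using assms(1) by simp
qed auto

text \<open>The elements represented by words of weight divisible by \<open>m\<close> form a subgroup containing all
  commutators.\<close>

lemma weight_dvd_if_derived:
  fixes G (structure)
  assumes G: "has_presentation G X R f"
    and rels: "\<And>l r. (l, r) \<in> R \<Longrightarrow> m dvd weight F l - weight F r"
    and u: "u \<in> words X" "word_eval G f u \<in> derived G (carrier G)"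
  shows "m dvd weight F u"
proof -
  from G have f: "f ` X \<subseteq> carrier G" and surj: "word_eval G f ` words X = carrier G"
    and eq: "\<And>u v. u \<in> words X \<Longrightarrow> v \<in> words X \<Longrightarrow> word_eval G f u = word_eval G f v \<Longrightarrow> pres_eq X R u v"
    unfolding has_presentation_def by auto
  interpret group G
    using G unfolding has_presentation_def by simp
  define K where "K = word_eval G f ` {u \<in> words X. m dvd weight F u}"
  have "subgroup K G"
  proof (rule subgroupI)
    show "K \<subseteq> carrier G"
      using word_eval_closed[OF f] by (auto simp: K_def)
    show "K \<noteq> {}"
      unfolding K_def by (auto intro!: exI[of _ "[]"])
    show "inv a \<in> K" if "a \<in> K" for a
    proof -
      from that obtain u where "u \<in> words X" "m dvd weight F u" "a = word_eval G f u"
        by (auto simp: K_def)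
      then show ?thesis
        unfolding K_def by (intro image_eqI[of _ _ "winv u"]) (auto simp: word_eval_winv[OF f])
    qed
    show "a \<otimes> b \<in> K" if "a \<in> K" "b \<in> K" for a b
    proof -
      from that obtain u v where "u \<in> words X" "m dvd weight F u" "a = word_eval G f u"
        "v \<in> words X" "m dvd weight F v" "b = word_eval G f v"
        by (auto simp: K_def)
      then show ?thesis
        unfolding K_def by (intro image_eqI[of _ _ "u @ v"]) (auto simp: word_eval_append[OF f])
    qed
  qed
  moreover have "derived_set G (carrier G) \<subseteq> K"
  proof clarsimp
    fix a b assume "a \<in> carrier G" "b \<in> carrier G"
    then obtain u v where "u \<in> words X" "a = word_eval G f u" "v \<in> words X" "b = word_eval G f v"
      using surj by (metis imageE)
    then show "a \<otimes> b \<otimes> inv a \<otimes> inv b \<in> K"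
      unfolding K_def
      by (intro image_eqI[of _ _ "wcomm u v"])
        (auto simp: wcomm_def word_eval_append[OF f] word_eval_winv[OF f] word_eval_closed[OF f] m_assoc)
  qed
  ultimately have "derived G (carrier G) \<subseteq> K"
    unfolding derived_def by (intro generate_subgroup_incl)
  \<comment> \<open>Membership in \<open>K\<close> yields only some word \<open>u'\<close> with the
    same value. Words with equal values are equal in the presented group, so
    \<open>weight_pres_eq\<close> carries the divisibility back to \<open>u\<close>.\<close>
  with u obtain u' where u': "u' \<in> words X" "m dvd weight F u'" "word_eval G f u = word_eval G f u'"
    by (auto simp: K_def)
  have "m dvd weight F u - weight F u'"
    using weight_pres_eq[OF rels] eq[OF u(1) u'(1,3)] by blast
  then show ?thesis
    using u'(2) by (metis diff_add_cancel dvd_add)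
qed


section \<open>Presentations with commuting generators\<close>

lemma pres_eq_append:
  assumes "pres_eq X R u v" "a \<in> words X" "b \<in> words X"
  shows "pres_eq X R (a @ u @ b) (a @ v @ b)"
  using assms(1)
proof induction
  case (refl u)
  then show ?case using assms by (intro pres_eq.refl) auto
next
  case (cancel u v x e)
  then show ?case
    using pres_eq.cancel[of "a @ u" X "v @ b" x R e] assms by simp
next
  case (rel u v l r)
  then show ?case
    using pres_eq.rel[of "a @ u" X "v @ b" l r R] assms by simp
qed (blast intro: pres_eq.sym pres_eq.trans)+

text \<open>\<open>R\<close> may contain further relations, so that squares can be added later.
  Commutation is assumed for positive letters only; \<open>swap\<close> extends it to
  inverses.\<close>

locale commuting_presentation =
  fixes X :: "'x set" and R :: "('x word \<times> 'x word) set"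
  assumes rels_words: "R \<subseteq> words X \<times> words X"
    and commuting: "\<And>x y. x \<in> X \<Longrightarrow> y \<in> X \<Longrightarrow> x \<noteq> y \<Longrightarrow>
      (letter x @ letter y, letter y @ letter x) \<in> R"
begin

abbreviation word_eq :: "'x word \<Rightarrow> 'x word \<Rightarrow> bool" (infix \<open>\<doteq>\<close> 50) where
  "word_eq \<equiv> pres_eq X R"

declare pres_eq.trans [trans]

lemma cancel_Nil: "x \<in> X \<Longrightarrow> [(x, e), (x, \<not> e)] \<doteq> []"
  using pres_eq.cancel[of "[]" X "[]" x R e] by simp

text \<open>Multiply the given equation by the inverse of \<open>(x, e)\<close> on both
  sides.\<close>

lemma swap_inverse:
  assumes "[(x, e), q] \<doteq> [q, (x, e)]" "x \<in> X" "fst q \<in> X"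
  shows "[(x, \<not> e), q] \<doteq> [q, (x, \<not> e)]"
proof -
  have "[(x, \<not> e), q] \<doteq> [(x, \<not> e), q, (x, e), (x, \<not> e)]"
    using pres_eq.sym[OF pres_eq_append[OF cancel_Nil[of x e], of "[(x, \<not> e), q]" "[]"]] assms
    by simp
  also have "\<dots> \<doteq> [(x, \<not> e), (x, e), q, (x, \<not> e)]"
    using pres_eq_append[OF pres_eq.sym[OF assms(1)], of "[(x, \<not> e)]" "[(x, \<not> e)]"] assms by simp
  also have "\<dots> \<doteq> [q, (x, \<not> e)]"
    using pres_eq_append[OF cancel_Nil[of x "\<not> e"], of "[]" "[q, (x, \<not> e)]"] assms by simp
  finally show ?thesis .
qed

lemma swap:
  assumes "fst p \<in> X" "fst q \<in> X"
  shows "[p, q] \<doteq> [q, p]"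
proof -
  obtain x d y e where pq: "p = (x, d)" "q = (y, e)"
    by (cases p, cases q)
  have *: "[(x, True), (y, True)] \<doteq> [(y, True), (x, True)]"
  proof (cases "x = y")
    case False
    then show ?thesis
      using pres_eq.rel[OF _ _ commuting[of x y], of "[]" X "[]"] assms pq by (simp add: letter_def)
  qed (use assms pq in \<open>auto intro: pres_eq.refl\<close>)
  \<comment> \<open>The sign of the first letter is adjusted first; the second sign follows from the
    same lemma applied to the reversed equation.\<close>
  have **: "[(x, d), (y, True)] \<doteq> [(y, True), (x, d)]"
    using * swap_inverse[OF *] assms pq by (cases d) auto
  show ?thesis
    using ** pres_eq.sym[OF swap_inverse[OF pres_eq.sym[OF **]]] assms pq by (cases e) auto
qed

lemma rotate_letter:
  assumes "fst p \<in> X" "u \<in> words X"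
  shows "p # u \<doteq> u @ [p]"
  using assms(2)
proof (induction u)
  case Nil
  then show ?case using assms by (auto intro: pres_eq.refl)
next
  case (Cons q u)
  have "p # q # u \<doteq> q # p # u"
    using pres_eq_append[OF swap[of p q], of "[]" u] assms Cons by simp
  also have "\<dots> \<doteq> q # u @ [p]"
    using pres_eq_append[OF Cons.IH, of "[q]" "[]"] Cons.prems by simp
  finally show ?case by simp
qed

lemma pull_letter:
  assumes "fst p \<in> X" "a \<in> words X" "b \<in> words X"
  shows "p # a @ b \<doteq> a @ p # b"
  using pres_eq_append[OF rotate_letter[OF assms(1,2)], of "[]" b] assms by simp

lemma winv_left: "u \<in> words X \<Longrightarrow> winv u @ u \<doteq> []"
proof (induction u)
  case Nil
  then show ?case by (auto intro: pres_eq.refl)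
next
  case (Cons p u)
  have "winv (p # u) @ p # u \<doteq> winv u @ u"
    using pres_eq_append[OF cancel_Nil[of "fst p" "\<not> snd p"], of "winv u" u] Cons.prems by simp
  also have "\<dots> \<doteq> []"
    using Cons by simp
  finally show ?case .
qed

lemma pres_eq_if_quotient_trivial:
  assumes "u \<in> words X" "v \<in> words X" "u @ winv v \<doteq> []"
  shows "u \<doteq> v"
proof -
  have "u \<doteq> u @ winv v @ v"
    using pres_eq.sym[OF pres_eq_append[OF winv_left[OF assms(2)], of u "[]"]] assms by simp
  also have "\<dots> \<doteq> v"
    using pres_eq_append[OF assms(3), of "[]" v] assms by simp
  finally show ?thesis .
qed

text \<open>Nothing cancels when all occurrences of \<open>x\<close> have the same sign
  \<open>e\<close>.\<close>

lemma exponent_sum_one_signed: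
  assumes "(x, \<not> e) \<notin> set u"
  shows "0 \<le> (if e then 1 else - 1) * exponent_sum x u"
  using assms by (induction u) (auto split: if_splits)

text \<open>Induction on the length. The first letter is moved next to a later inverse of it and
  cancelled. Without such an inverse its exponent sum is nonzero, so the letter lies in
  \<open>S\<close>; by parity it occurs a second time with the same sign, and a square relation
  removes the pair.\<close>

lemma trivial_if_exponent_sums_trivial:
  assumes squares: "\<And>s. s \<in> S \<Longrightarrow> (letter s @ letter s, []) \<in> R"
    and "u \<in> words X" "\<And>x. x \<in> X \<Longrightarrow> (if x \<in> S then 2 else 0) dvd exponent_sum x u"
  shows "u \<doteq> []"
  using assms(2,3)
proof (induction "length u" arbitrary: u rule: less_induct)
  case less
  show ?case
  proof (cases u)
    case Nil
    then show ?thesis by (auto intro: pres_eq.refl)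
  next
    case (Cons p u')
    obtain x e where p: "p = (x, e)" by (cases p)
    have x: "x \<in> X" "u' \<in> words X" using less.prems Cons p by auto
    show ?thesis
    proof (cases "(x, \<not> e) \<in> set u'")
      case True
      then obtain a b where u': "u' = a @ (x, \<not> e) # b"
        by (meson split_list)
      have "u \<doteq> a @ (x, e) # (x, \<not> e) # b"
        using pull_letter[of p a "(x, \<not> e) # b"] x Cons p u' by simp
      also have "\<dots> \<doteq> a @ b"
        using pres_eq_append[OF cancel_Nil[of x e], of a b] x u' by simp
      also have "\<dots> \<doteq> []"
      proof (rule less.hyps)
        fix y assume "y \<in> X"
        then show "(if y \<in> S then 2 else 0) dvd exponent_sum y (a @ b)"
          using less.prems(2)[of y] Cons p u' by (cases e) auto
      qed (use Cons u' x in auto)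
      finally show ?thesis .
    next
      case False
      \<comment> \<open>All occurrences of \<open>x\<close> in \<open>u\<close> have sign
        \<open>e\<close>, and there is at least one. For \<open>x\<close> outside \<open>S\<close>
        the hypothesis \<open>0 dvd\<close> would make the sum vanish.\<close>
      have nz: "exponent_sum x u \<noteq> 0"
        using exponent_sum_one_signed[OF False] Cons p by (auto split: if_splits)
      then have "x \<in> S"
        using less.prems(2)[OF x(1)] by (auto split: if_splits)
      have "(x, e) \<in> set u'"
      proof (rule ccontr)
        \<comment> \<open>Then \<open>x\<close> does not occur in \<open>u'\<close> at all, and its
          exponent sum in \<open>u\<close> would be odd.\<close>
        assume "(x, e) \<notin> set u'"
        then have "exponent_sum x u' = 0"
          using exponent_sum_one_signed[OF False] exponent_sum_one_signed[of x "\<not> e" u']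
          by (auto split: if_splits)
        then have "\<bar>exponent_sum x u\<bar> = 1"
          using Cons p by simp
        then show False
          using less.prems(2)[OF x(1)] \<open>x \<in> S\<close> by presburger
      qed
      then obtain a b where u': "u' = a @ (x, e) # b"
        by (meson split_list)
      have square: "[(x, True), (x, True)] \<doteq> []"
        using pres_eq.rel[OF _ _ squares[OF \<open>x \<in> S\<close>], of "[]" X "[]"] by (simp add: letter_def)
      \<comment> \<open>Only squares of positive letters are relations; the square of the inverse is
        killed by appending two copies of \<open>x\<close> and cancelling.\<close>
      have "[(x, False), (x, False)] \<doteq> [(x, False), (x, False), (x, True), (x, True)]"
        using pres_eq.sym[OF pres_eq_append[OF square, of "[(x, False), (x, False)]" "[]"]] x by simp
      also have "\<dots> \<doteq> [(x, False), (x, True)]"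
        using pres_eq.cancel[of "[(x, False)]" X "[(x, True)]" x R False] x by simp
      also have "\<dots> \<doteq> []"
        using cancel_Nil[of x False] x by simp
      finally have square': "[(x, e), (x, e)] \<doteq> []"
        using square by (cases e) auto
      have "u \<doteq> a @ (x, e) # (x, e) # b"
        using pull_letter[of p a "(x, e) # b"] x Cons p u' by simp
      also have "\<dots> \<doteq> a @ b"
        using pres_eq_append[OF square', of a b] x u' by simp
      also have "\<dots> \<doteq> []"
      proof (rule less.hyps)
        fix y assume "y \<in> X"
        \<comment> \<open>Deleting the pair changes only the exponent sum of \<open>x\<close>, by 2
          or -2, which is harmless because \<open>x\<close> lies in \<open>S\<close>.\<close>
        have "exponent_sum y u = exponent_sum y (a @ b) + 2 * (if y = x then if e then 1 else -1 else 0)"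
          using Cons p u' by auto
        then show "(if y \<in> S then 2 else 0) dvd exponent_sum y (a @ b)"
          using less.prems(2)[OF \<open>y \<in> X\<close>] \<open>x \<in> S\<close> by (auto split: if_splits)
      qed (use Cons u' x in auto)
      finally show ?thesis .
    qed
  qed
qed

end


section \<open>Abelian groups with free and order two generators\<close>

lemma weight_replicate [simp]:
  "weight F (replicate m p) = int m * (if snd p then F (fst p) else - F (fst p))"
  by (induction m) (auto simp: algebra_simps)

lemma word_with_exponent_sums:
  assumes "finite X"
  shows "\<exists>u\<in>words X. \<forall>x. exponent_sum x u = (if x \<in> X then e x else 0)"
  using assms
proof induction
  case empty
  then show ?case by (auto intro: bexI[of _ "[]"])
next
  case (insert y X)
  then obtain u where u: "u \<in> words X" "\<And>x. exponent_sum x u = (if x \<in> X then e x else 0)"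
    by blast
  \<comment> \<open>The letter \<open>y\<close> raised to the power \<open>e y\<close>; the Boolean
    carries the sign.\<close>
  let ?v = "replicate (nat \<bar>e y\<bar>) (y, e y \<ge> 0)"
  have "?v \<in> words (insert y X)" "u \<in> words (insert y X)"
    using u(1) by (auto simp: words_def in_lists_conv_set)
  then show ?case
    using u(2) insert(2) by (intro bexI[of _ "?v @ u"]) auto
qed

definition commutation_rels :: "'x set \<Rightarrow> ('x word \<times> 'x word) set" where
  "commutation_rels X =
     {(letter x @ letter y, letter y @ letter x) | x y. x \<in> X \<and> y \<in> X \<and> x \<noteq> y}"

definition square_rels :: "'x set \<Rightarrow> ('x word \<times> 'x word) set" where
  "square_rels S = {(letter s @ letter s, []) | s. s \<in> S}"

text \<open>The axioms describe \<open>H\<close> as a direct sum of cyclic groups generated by the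
  letters, of order 2 for \<open>S\<close> and infinite otherwise. \<open>independent\<close> bounds
  the kernel of the evaluation, with modulus 0 standing for infinite order.\<close>

locale basis_with_involutions = comm_group H for H (structure) +
  fixes X S :: "'x set" and f :: "'x \<Rightarrow> 'a"
  assumes letters_closed: "f ` X \<subseteq> carrier H"
    and involutions_subset: "S \<subseteq> X"
    and involutions: "\<And>s. s \<in> S \<Longrightarrow> f s \<otimes> f s = \<one>"
    and generates: "carrier H \<subseteq> word_eval H f ` words X"
    and independent: "\<And>u x. u \<in> words X \<Longrightarrow> word_eval H f u = \<one> \<Longrightarrow> x \<in> X \<Longrightarrow>
      int (if x \<in> S then 2 else 0) dvd exponent_sum x u"
begin

lemma word_eval_range: "word_eval H f ` words X = carrier H"
  using generates word_eval_closed[OF letters_closed] by auto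

lemma rels_in_words: "commutation_rels X \<union> square_rels S \<subseteq> words X \<times> words X"
  using involutions_subset by (auto simp: commutation_rels_def square_rels_def)

sublocale pres: commuting_presentation X "commutation_rels X \<union> square_rels S"
  by unfold_locales (use rels_in_words in \<open>auto simp: commutation_rels_def\<close>)

lemma word_eval_eq_if_pres_eq:
  assumes "pres_eq X (commutation_rels X \<union> square_rels S) u v"
  shows "word_eval H f u = word_eval H f v"
  using letters_closed rels_in_words _ assms
proof (rule word_eval_cong_pres_eq)
  fix l r assume "(l, r) \<in> commutation_rels X \<union> square_rels S"
  then show "word_eval H f l = word_eval H f r"
    using letters_closed involutions involutions_subset m_comm
    by (auto simp: commutation_rels_def square_rels_def letter_def image_subset_iff subset_iff)
qed

lemma exponent_sums_if_word_eval_eq: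
  assumes "u \<in> words X" "v \<in> words X" "word_eval H f u = word_eval H f v" "x \<in> X"
  shows "int (if x \<in> S then 2 else 0) dvd exponent_sum x u - exponent_sum x v"
proof -
  have "word_eval H f (u @ winv v) = \<one>"
    using assms word_eval_closed[OF letters_closed]
    by (simp add: word_eval_append[OF letters_closed] word_eval_winv[OF letters_closed])
  then show ?thesis
    using independent[of "u @ winv v" x] assms by simp
qed

text \<open>This closes a circle with the two preceding lemmas: equality under the relations,
  equality of values and congruence of all exponent sums are equivalent.\<close>

lemma pres_eq_if_exponent_sums:
  assumes "u \<in> words X" "v \<in> words X"
    "\<And>x. x \<in> X \<Longrightarrow> int (if x \<in> S then 2 else 0) dvd exponent_sum x u - exponent_sum x v"
  shows "pres_eq X (commutation_rels X \<union> square_rels S) u v"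
proof (rule pres.pres_eq_if_quotient_trivial[OF assms(1,2)])
  show "pres_eq X (commutation_rels X \<union> square_rels S) (u @ winv v) []"
  proof (rule pres.trivial_if_exponent_sums_trivial[where S = S])
    fix x assume "x \<in> X"
    then show "(if x \<in> S then 2 else 0) dvd exponent_sum x (u @ winv v)"
      using assms(3)[of x] by (auto split: if_splits)
  qed (use assms in \<open>auto simp: square_rels_def\<close>)
qed

lemma has_presentation_basis:
  "has_presentation H X (commutation_rels X \<union> square_rels S) f"
  unfolding has_presentation_def
proof (intro conjI ballI iffI)
  fix u v assume "u \<in> words X" "v \<in> words X" "word_eval H f u = word_eval H f v"
  then show "pres_eq X (commutation_rels X \<union> square_rels S) u v"
    by (intro pres_eq_if_exponent_sums exponent_sums_if_word_eval_eq)
qed (fact is_group letters_closed rels_in_words word_eval_range | erule word_eval_eq_if_pres_eq)+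

text \<open>The coordinates of an element are the exponent sums of a word for it, reduced by the
  moduli; modulus 0 leaves an integer unchanged.\<close>

lemma iso_product_group_basis:
  assumes "finite X"
  shows "H \<cong> product_group X (\<lambda>x. integer_mod_group (if x \<in> S then 2 else 0))"
proof -
  define m :: "'x \<Rightarrow> nat" where "m x = (if x \<in> S then 2 else 0)" for x
  \<comment> \<open>An arbitrary word for \<open>q\<close>; \<open>h_eval\<close> shows that the
    choice does not affect the coordinates.\<close>
  define rep where "rep q = (SOME u. u \<in> words X \<and> word_eval H f u = q)" for q
  define h where "h q = (\<lambda>x\<in>X. exponent_sum x (rep q) mod int (m x))" for q
  have rep: "rep q \<in> words X" "word_eval H f (rep q) = q" if "q \<in> carrier H" for q
    using someI_ex[of "\<lambda>u. u \<in> words X \<and> word_eval H f u = q"] that generates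
    unfolding rep_def by blast+
  have h_eval: "h (word_eval H f u) x = exponent_sum x u mod int (m x)"
    if "u \<in> words X" "x \<in> X" for u x
    using exponent_sums_if_word_eval_eq[of "rep (word_eval H f u)" u x] that
      rep[OF word_eval_closed[OF letters_closed that(1)]]
    by (auto simp: h_def mod_eq_dvd_iff m_def)
  have h_closed: "h q \<in> (\<Pi>\<^sub>E x\<in>X. carrier (integer_mod_group (m x)))" for q
    by (auto simp: h_def carrier_integer_mod_group m_def)
  have "h \<in> iso H (product_group X (\<lambda>x. integer_mod_group (m x)))"
  proof (rule isoI)
    show "h \<in> hom H (product_group X (\<lambda>x. integer_mod_group (m x)))"
    proof (rule homI)
      fix q r assume "q \<in> carrier H" "r \<in> carrier H"
      then obtain u v where uv: "u \<in> words X" "q = word_eval H f u"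
        "v \<in> words X" "r = word_eval H f v"
        using generates by blast
      then have "h (q \<otimes> r) x = (h q x + h r x) mod int (m x)" if "x \<in> X" for x
        using h_eval[of "u @ v" x] that
        by (simp add: h_eval word_eval_append[OF letters_closed] mod_add_eq)
      moreover have "h (q \<otimes> r) x = undefined" if "x \<notin> X" for x
        using that by (simp add: h_def)
      ultimately show "h (q \<otimes> r) = h q \<otimes>\<^bsub>product_group X (\<lambda>x. integer_mod_group (m x))\<^esub> h r"
        unfolding mult_product_group mult_integer_mod_group by (intro ext) (simp add: restrict_def)
    qed (use h_closed in simp)
    have inj: "q = r" if qr: "q \<in> carrier H" "r \<in> carrier H" "h q = h r" for q r
    proof -
      obtain u v where uv: "u \<in> words X" "q = word_eval H f u"
        "v \<in> words X" "r = word_eval H f v"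
        using generates qr(1,2) by blast
      have "int (m x) dvd exponent_sum x u - exponent_sum x v" if "x \<in> X" for x
        using qr(3) h_eval[OF uv(1) that] h_eval[OF uv(3) that] uv by (metis mod_eq_dvd_iff)
      then show ?thesis
        using word_eval_eq_if_pres_eq[OF pres_eq_if_exponent_sums[OF uv(1,3)]] uv by (simp add: m_def)
    qed
    have surj: "e \<in> h ` carrier H"
      if e: "e \<in> (\<Pi>\<^sub>E x\<in>X. carrier (integer_mod_group (m x)))" for e
    proof -
      \<comment> \<open>The prescribed coordinates serve as exponent sums. They are already reduced,
        so taking remainders does not alter them.\<close>
      obtain u where u: "u \<in> words X" "\<And>x. exponent_sum x u = (if x \<in> X then e x else 0)"
        using word_with_exponent_sums[OF assms, of e] by blast
      have "h (word_eval H f u) x = e x" for x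
      proof (cases "x \<in> X")
        case True
        then have "e x \<in> carrier (integer_mod_group (m x))"
          using e by auto
        then show ?thesis
          using h_eval[OF u(1) True] True u(2) by (auto simp: carrier_integer_mod_group split: if_splits)
      next
        case False
        then show ?thesis
          using e by (auto simp: h_def)
      qed
      then show ?thesis
        using word_eval_closed[OF letters_closed u(1)] by (intro image_eqI ext) auto
    qed
    show "bij_betw h (carrier H) (carrier (product_group X (\<lambda>x. integer_mod_group (m x))))"
      unfolding bij_betw_def carrier_product_group
      using inj surj h_closed by (intro conjI inj_onI equalityI subsetI) blast+
  qed
  then show ?thesis
    unfolding m_def by (rule is_isoI)
qed

end

section \<open>Isomorphisms between products of groups\<close>

lemma product_group_reindex:
  assumes b: "bij_betw b J I" and G: "\<And>j. j \<in> J \<Longrightarrow> G (b j) = G' j"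
  shows "product_group I G \<cong> product_group J G'"
proof -
  let ?h = "\<lambda>x. \<lambda>j\<in>J. x (b j)" and ?c = "inv_into J b"
  have bJ: "b j \<in> I" if "j \<in> J" for j
    using b that by (auto simp: bij_betw_def)
  have c: "?c i \<in> J" "b (?c i) = i" if "i \<in> I" for i
    using b that by (auto simp: bij_betw_def inv_into_into f_inv_into_f)
  have cb: "?c (b j) = j" if "j \<in> J" for j
    using b that by (auto simp: bij_betw_def)
  have "?h \<in> iso (product_group I G) (product_group J G')"
  proof (rule isoI)
    show "?h \<in> hom (product_group I G) (product_group J G')"
      using bJ by (intro homI) (auto simp: PiE_iff fun_eq_iff G[symmetric])
    show "bij_betw ?h (carrier (product_group I G)) (carrier (product_group J G'))"
    proof (rule bij_betw_byWitness[where f' = "\<lambda>y. \<lambda>i\<in>I. y (?c i)"])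
      show "(\<lambda>y. \<lambda>i\<in>I. y (?c i)) ` carrier (product_group J G') \<subseteq> carrier (product_group I G)"
        using c G by (auto simp: PiE_iff) (metis c)
    qed (use bJ c cb in \<open>auto simp: PiE_iff fun_eq_iff extensional_def G[symmetric]\<close>)
  qed
  then show ?thesis
    by (rule is_isoI)
qed

lemma product_group_Un_disjoint:
  assumes "I \<inter> J = {}"
  shows "product_group (I \<union> J) G \<cong> product_group I G \<times>\<times> product_group J G"
proof -
  let ?h = "\<lambda>x. (restrict x I, restrict x J)"
  have "?h \<in> iso (product_group (I \<union> J) G) (product_group I G \<times>\<times> product_group J G)"
  proof (rule isoI)
    show "?h \<in> hom (product_group (I \<union> J) G) (product_group I G \<times>\<times> product_group J G)"
      by (intro homI) (auto simp: PiE_iff fun_eq_iff)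
    show "bij_betw ?h (carrier (product_group (I \<union> J) G))
      (carrier (product_group I G \<times>\<times> product_group J G))"
      by (rule bij_betw_byWitness[where f' = "\<lambda>(a, b). \<lambda>i\<in>I \<union> J. if i \<in> I then a i else b i"])
        (use assms in \<open>auto simp: PiE_iff fun_eq_iff extensional_def\<close>)
  qed
  then show ?thesis
    by (rule is_isoI)
qed


section \<open>The braid group\<close>

text \<open>The letters \<open>LZeta i\<close> keep the class \<open>QZeta\<close> for
  \<open>g \<ge> 1\<close> too; it is then not in \<open>ab_gens\<close>, which marks them as
  trivial in the quotient.\<close>

fun ab_class :: "braid_letter \<Rightarrow> ab_letter" where
  "ab_class (LSigma i) = QSigma"
| "ab_class (LSigmat i) = QSigmat"
| "ab_class (LZeta i) = QZeta"
| "ab_class (LA i) = QA i"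
| "ab_class (LB i) = QB i"
| "ab_class (LAt i) = QAt i"
| "ab_class (LBt i) = QBt i"

text \<open>A section of \<open>ab_class\<close>, taking index 1 in each family whose letters become
  equal.\<close>

fun ab_rep :: "ab_letter \<Rightarrow> braid_letter" where
  "ab_rep QSigma = LSigma 1"
| "ab_rep QSigmat = LSigmat 1"
| "ab_rep QZeta = LZeta 1"
| "ab_rep (QA i) = LA i"
| "ab_rep (QB i) = LB i"
| "ab_rep (QAt i) = LAt i"
| "ab_rep (QBt i) = LBt i"

lemma ab_class_rep [simp]: "ab_class (ab_rep x) = x"
  by (cases x) auto

definition ab_squares :: "nat \<Rightarrow> nat \<Rightarrow> nat \<Rightarrow> ab_letter set" where
  "ab_squares k n g = (if g \<ge> 1 then Shat k n else {})"

lemma ab_rels_eq: "ab_rels k n g = commutation_rels (ab_gens k n g) \<union> square_rels (ab_squares k n g)"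
  by (auto simp: ab_rels_def commutation_rels_def square_rels_def ab_squares_def)

lemma ab_gens_iff [simp]:
  "QSigma \<in> ab_gens k n g \<longleftrightarrow> k \<ge> 2" "QSigmat \<in> ab_gens k n g \<longleftrightarrow> n \<ge> 2"
  "QZeta \<in> ab_gens k n g \<longleftrightarrow> g = 0"
  "QA i \<in> ab_gens k n g \<longleftrightarrow> i \<in> {1..g}" "QB i \<in> ab_gens k n g \<longleftrightarrow> i \<in> {1..g}"
  "QAt i \<in> ab_gens k n g \<longleftrightarrow> i \<in> {1..g}" "QBt i \<in> ab_gens k n g \<longleftrightarrow> i \<in> {1..g}"
  by (auto simp: ab_gens_def Shat_def Zhat_def)

lemma braid_gens_iff [simp]:
  "LSigma i \<in> braid_gens k n g \<longleftrightarrow> i \<in> {1..<k}" "LSigmat i \<in> braid_gens k n g \<longleftrightarrow> i \<in> {1..<n}"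
  "LZeta i \<in> braid_gens k n g \<longleftrightarrow> i \<in> {1..n}"
  "LA i \<in> braid_gens k n g \<longleftrightarrow> i \<in> {1..g}" "LB i \<in> braid_gens k n g \<longleftrightarrow> i \<in> {1..g}"
  "LAt i \<in> braid_gens k n g \<longleftrightarrow> i \<in> {1..g}" "LBt i \<in> braid_gens k n g \<longleftrightarrow> i \<in> {1..g}"
  by (auto simp: braid_gens_def S_letters_def St_letters_def Z_letters_def AB_letters_def
      ABt_letters_def)

lemma ab_squares_subset: "ab_squares k n g \<subseteq> ab_gens k n g"
  by (auto simp: ab_squares_def ab_gens_def)

lemma ab_rep_in_braid_gens:
  "n \<ge> 1 \<Longrightarrow> x \<in> ab_gens k n g \<Longrightarrow> ab_rep x \<in> braid_gens k n g"
  by (cases x) auto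

text \<open>The relations are balanced in every class, with exceptions that occur only for
  \<open>g \<ge> 1\<close>. In \<open>handle_pair\<close> one \<sigma> faces three, which is
  balanced modulo 2; \<open>at_b\<close> and \<open>bt_a\<close> change the number of \<zeta>, whose
  class is then not in \<open>ab_gens\<close>.\<close>

lemma braid_rels_exponent_sum:
  assumes "x \<in> ab_gens k n g" "(l, r) \<in> braid_rels k n g"
  shows "int (if x \<in> ab_squares k n g then 2 else 0) dvd
    weight (\<lambda>y. of_bool (ab_class y = x)) l - weight (\<lambda>y. of_bool (ab_class y = x)) r"
proof -
  have S: "k \<ge> 2 \<Longrightarrow> g \<ge> 1 \<Longrightarrow> QSigma \<in> ab_squares k n g"
    "n \<ge> 2 \<Longrightarrow> g \<ge> 1 \<Longrightarrow> QSigmat \<in> ab_squares k n g"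
    by (auto simp: ab_squares_def Shat_def)
  from assms(2) consider "(l, r) \<in> surface_braid_rels k g sg ha hb" | "(l, r) \<in> zeta_rels k n g"
    | "(l, r) \<in> surface_braid_rels n g sgt hat hbt" | "(l, r) \<in> action_rels k n g"
    by (auto simp: braid_rels_def)
  then show ?thesis
  proof cases
    case 1
    then show ?thesis by cases (use assms(1) S in auto)
  next
    case 2
    then show ?thesis by cases auto
  next
    case 3
    then show ?thesis by cases (use assms(1) S in auto)
  next
    case 4
    then show ?thesis by cases (use assms(1) in auto)
  qed
qed

section \<open>The braid relations in an abelian group\<close>

context comm_group
begin

text \<open>Both sides of the braid relation contain the product of the two values, which
  cancels.\<close>

lemma eq_if_braid_rel:
  assumes c: "f x \<in> carrier G" "f y \<in> carrier G"
    and eq: "word_eval G f (letter x @ letter y @ letter x) = word_eval G f (letter y @ letter x @ letter y)"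
  shows "f x = f y"
proof -
  have "word_eval G f (letter x @ letter y @ letter x) = f x \<otimes> (f x \<otimes> f y)"
    "word_eval G f (letter y @ letter x @ letter y) = f y \<otimes> (f x \<otimes> f y)"
    using c by (simp_all add: letter_def m_ac)
  then have "f x \<otimes> (f x \<otimes> f y) = f y \<otimes> (f x \<otimes> f y)"
    using eq by argo
  then show ?thesis
    using c by (subst (asm) right_cancel) auto
qed

lemma word_eval_conj:
  assumes "f x \<in> carrier G" "f y \<in> carrier G"
  shows "word_eval G f (letter x @ letter y @ winv (letter x)) = f y"
  using assms by (simp add: letter_def m_lcomm[of "f x" "f y"])

text \<open>Up to order, the right side is the left side times the square of
  \<open>f s\<close>.\<close>

lemma square_if_handle_rel:
  assumes c: "f a \<in> carrier G" "f b \<in> carrier G" "f s \<in> carrier G"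
    and eq: "word_eval G f (letter a @ letter s @ letter b) =
      word_eval G f (letter s @ letter b @ letter s @ letter a @ letter s)"
  shows "f s \<otimes> f s = \<one>"
proof -
  have *: "word_eval G f (letter a @ letter s @ letter b) = f a \<otimes> (f s \<otimes> f b)"
    "word_eval G f (letter s @ letter b @ letter s @ letter a @ letter s) =
      (f a \<otimes> (f s \<otimes> f b)) \<otimes> (f s \<otimes> f s)"
    using c by (simp_all add: letter_def m_ac)
  show ?thesis
    using eq unfolding * by (subst (asm) l_cancel_one') (use c in auto)
qed

text \<open>Braid relations identify neighbouring \<sigma>; \<open>sigmat_zeta_Suc\<close>
  identifies neighbouring \<zeta>, as conjugation is trivial; \<open>at_b\<close> kills \<zeta>, and
  \<open>handle_pair\<close> gives the squares.\<close>

lemma braid_rels_identify: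
  assumes f: "f ` braid_gens k n g \<subseteq> carrier G"
    and rels: "\<And>l r. (l, r) \<in> braid_rels k n g \<Longrightarrow> word_eval G f l = word_eval G f r"
  shows "i \<in> {1..<k} \<Longrightarrow> f (LSigma i) = f (LSigma 1)"
    and "i \<in> {1..<n} \<Longrightarrow> f (LSigmat i) = f (LSigmat 1)"
    and "i \<in> {1..n} \<Longrightarrow> f (LZeta i) = f (LZeta 1)"
    and "g \<ge> 1 \<Longrightarrow> i \<in> {1..n} \<Longrightarrow> f (LZeta i) = \<one>"
    and "g \<ge> 1 \<Longrightarrow> k \<ge> 2 \<Longrightarrow> f (LSigma 1) \<otimes> f (LSigma 1) = \<one>"
    and "g \<ge> 1 \<Longrightarrow> n \<ge> 2 \<Longrightarrow> f (LSigmat 1) \<otimes> f (LSigmat 1) = \<one>"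
proof -
  have cl: "f y \<in> carrier G" if "y \<in> braid_gens k n g" for y
    using that f by auto
  show "f (LSigma i) = f (LSigma 1)" if "i \<in> {1..<k}" for i
    using that
  proof (induction i)
    case (Suc i)
    show ?case
    \<comment> \<open>Indices start at 1, so \<open>i = 0\<close> is the base case; afterwards the
      relation links \<open>i\<close> and \<open>i + 1\<close>.\<close>
    proof (cases "i = 0")
      case False
      have rel: "(sg i @ sg (i + 1) @ sg i, sg (i + 1) @ sg i @ sg (i + 1)) \<in> braid_rels k n g"
        unfolding braid_rels_def using False Suc.prems surface_braid_rels.braid[of i k sg] by auto
      have "f (LSigma i) = f (LSigma (i + 1))"
        by (rule eq_if_braid_rel[of f, OF cl cl rels[OF rel]]) (use False Suc.prems in auto)
      then show ?thesis
        using Suc False by auto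
    qed simp
  qed simp
  show "f (LSigmat i) = f (LSigmat 1)" if "i \<in> {1..<n}" for i
    using that
  proof (induction i)
    case (Suc i)
    show ?case
    proof (cases "i = 0")
      case False
      have rel: "(sgt i @ sgt (i + 1) @ sgt i, sgt (i + 1) @ sgt i @ sgt (i + 1)) \<in> braid_rels k n g"
        unfolding braid_rels_def using False Suc.prems surface_braid_rels.braid[of i n sgt] by auto
      have "f (LSigmat i) = f (LSigmat (i + 1))"
        by (rule eq_if_braid_rel[of f, OF cl cl rels[OF rel]]) (use False Suc.prems in auto)
      then show ?thesis
        using Suc False by auto
    qed simp
  qed simp
  show zeta: "f (LZeta i) = f (LZeta 1)" if "i \<in> {1..n}" for i
    using that
  proof (induction i)
    case (Suc i)
    show ?case
    proof (cases "i = 0")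
      case False
      have rel: "(sgt i @ ze (i + 1) @ winv (sgt i), ze i) \<in> braid_rels k n g"
        unfolding braid_rels_def using False Suc.prems action_rels.sigmat_zeta_Suc[of i n] by auto
      from rels[OF rel] have "f (LZeta (i + 1)) = f (LZeta i)"
        using False Suc.prems by (subst (asm) word_eval_conj) (auto simp: cl)
      then show ?thesis
        using Suc False by auto
    qed simp
  qed simp
  show "f (LZeta i) = \<one>" if "g \<ge> 1" "i \<in> {1..n}" for i
  proof -
    \<comment> \<open>With trivial conjugation this relation says that \<open>hb 1\<close> and
      \<open>hb 1 @ ze 1\<close> have the same value.\<close>
    have rel: "(hat 1 @ hb 1 @ winv (hat 1), hb 1 @ ze 1) \<in> braid_rels k n g"
      unfolding braid_rels_def using that action_rels.at_b[of n 1 g] by auto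
    have z: "f (LAt 1) \<in> carrier G" "f (LB 1) \<in> carrier G" "f (LZeta 1) \<in> carrier G"
      using that by (auto intro!: cl)
    have "f (LB 1) = f (LB 1) \<otimes> f (LZeta 1)"
      using rels[OF rel] unfolding word_eval_conj[of f, OF z(1,2)] using z by (simp add: letter_def)
    then have "f (LZeta 1) = \<one>"
      by (subst (asm) l_cancel_one') (use z in auto)
    then show ?thesis
      using zeta[OF that(2)] by simp
  qed
  show "f (LSigma 1) \<otimes> f (LSigma 1) = \<one>" if "g \<ge> 1" "k \<ge> 2"
  proof -
    have rel: "(ha 1 @ sg 1 @ hb 1, sg 1 @ hb 1 @ sg 1 @ ha 1 @ sg 1) \<in> braid_rels k n g"
      unfolding braid_rels_def using that surface_braid_rels.handle_pair[of k 1 g ha sg hb] by auto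
    show ?thesis
      by (rule square_if_handle_rel[of f, OF cl cl cl rels[OF rel]]) (use that in auto)
  qed
  show "f (LSigmat 1) \<otimes> f (LSigmat 1) = \<one>" if "g \<ge> 1" "n \<ge> 2"
  proof -
    have rel: "(hat 1 @ sgt 1 @ hbt 1, sgt 1 @ hbt 1 @ sgt 1 @ hat 1 @ sgt 1) \<in> braid_rels k n g"
      unfolding braid_rels_def using that surface_braid_rels.handle_pair[of n 1 g hat sgt hbt] by auto
    show ?thesis
      by (rule square_if_handle_rel[of f, OF cl cl cl rels[OF rel]]) (use that in auto)
  qed
qed

end

section \<open>The quotient by the commutator subgroup\<close>

lemma word_eval_map: "word_eval G f (map (map_prod h id) u) = word_eval G (f \<circ> h) u"
  by (induction u) auto

text \<open>\<open>n \<ge> 1\<close> ensures that \<open>LZeta 1\<close>, which represents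
  \<open>QZeta\<close>, is a braid generator.\<close>

locale mixed_braid_presentation = group G for G (structure) +
  fixes k n g :: nat and v :: "braid_letter \<Rightarrow> 'a"
  assumes n: "n \<ge> 1"
    and pres: "has_presentation G (braid_gens k n g) (braid_rels k n g) v"
begin

abbreviation Q :: "'a set monoid" where
  "Q \<equiv> G Mod Gamma2 G"

abbreviation r :: "'a \<Rightarrow> 'a set" where
  "r \<equiv> Gamma2_proj G"

abbreviation w :: "ab_letter \<Rightarrow> 'a set" where
  "w \<equiv> r \<circ> v \<circ> ab_rep"

lemma v_closed: "v ` braid_gens k n g \<subseteq> carrier G"
  using pres by (simp add: has_presentation_def)

sublocale Q: comm_group Q
  unfolding Gamma2_def by (rule derived_quot_is_comm_group)

lemma r_hom: "r \<in> hom G Q"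
  using normal.r_coset_hom_Mod[OF derived_self_is_normal]
  by (simp add: Gamma2_proj_def[abs_def] Gamma2_def)

lemma rv_closed: "(r \<circ> v) ` braid_gens k n g \<subseteq> carrier Q"
  using r_hom v_closed by (auto simp: hom_def)

lemma w_closed: "w ` ab_gens k n g \<subseteq> carrier Q"
  using rv_closed ab_rep_in_braid_gens[OF n] by (auto simp: image_subset_iff)

lemma rels_in_Q:
  assumes "(l, l') \<in> braid_rels k n g"
  shows "word_eval Q (r \<circ> v) l = word_eval Q (r \<circ> v) l'"
proof -
  have l: "l \<in> words (braid_gens k n g)" "l' \<in> words (braid_gens k n g)"
    using braid_rels_words assms by blast+
  have "pres_eq (braid_gens k n g) (braid_rels k n g) l l'"
    using pres_eq.rel[OF _ _ assms, of "[]" _ "[]"] by simp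
  then have "word_eval G v l = word_eval G v l'"
    using pres l by (simp add: has_presentation_def)
  then show ?thesis
    using word_eval_hom[OF Q.is_group r_hom v_closed] l by simp
qed

lemmas identify = Q.braid_rels_identify[OF rv_closed rels_in_Q]

text \<open>By \<open>identify\<close>, a letter may be replaced by the representative of its class.
  The second branch occurs only for the letters \<open>LZeta i\<close> with
  \<open>g \<ge> 1\<close>.\<close>

lemma rv_eq:
  assumes "y \<in> braid_gens k n g"
  shows "(r \<circ> v) y = (if ab_class y \<in> ab_gens k n g then w (ab_class y) else \<one>\<^bsub>Q\<^esub>)"
proof (cases y)
  case (LSigma i)
  then show ?thesis using assms identify(1)[of i] by auto
next
  case (LSigmat i)
  then show ?thesis using assms identify(2)[of i] by auto
next
  case (LZeta i)
  then show ?thesis using assms identify(3,4)[of i] by auto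
qed (use assms in auto)

text \<open>Each letter is replaced by its class with the same sign; a letter whose class is not in
  \<open>ab_gens\<close> has trivial image and is dropped.\<close>

lemma word_over_ab_gens:
  assumes "u \<in> words (braid_gens k n g)"
  shows "\<exists>u'\<in>words (ab_gens k n g). word_eval Q w u' = word_eval Q (r \<circ> v) u"
  using assms
proof (induction u)
  case Nil
  then show ?case by (intro bexI[of _ "[]"]) auto
next
  case (Cons p u)
  then obtain u' where u': "u' \<in> words (ab_gens k n g)" "word_eval Q w u' = word_eval Q (r \<circ> v) u"
    by (auto simp del: o_apply)
  have p: "fst p \<in> braid_gens k n g"
    using Cons.prems by simp
  show ?case
  proof (cases "ab_class (fst p) \<in> ab_gens k n g")
    case True
    then show ?thesis
      using u' rv_eq[OF p] by (intro bexI[of _ "(ab_class (fst p), snd p) # u'"]) (auto simp del: o_apply one_FactGroup mult_FactGroup)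
  next
    case False
    have "word_eval Q (r \<circ> v) (p # u) = word_eval Q w u'"
      using False u' rv_eq[OF p] Q.word_eval_closed[OF w_closed u'(1)]
      by (auto simp del: o_apply one_FactGroup mult_FactGroup)
    then show ?thesis
      using u'(1) by metis
  qed
qed

sublocale ab: basis_with_involutions Q "ab_gens k n g" "ab_squares k n g" w
proof
  show "w ` ab_gens k n g \<subseteq> carrier Q"
    by (rule w_closed)
  show "ab_squares k n g \<subseteq> ab_gens k n g"
    by (rule ab_squares_subset)
  show "w s \<otimes>\<^bsub>Q\<^esub> w s = \<one>\<^bsub>Q\<^esub>" if "s \<in> ab_squares k n g" for s
  proof -
    from that consider "s = QSigma" "g \<ge> 1" "k \<ge> 2" | "s = QSigmat" "g \<ge> 1" "n \<ge> 2"
      by (auto simp: ab_squares_def Shat_def split: if_splits)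
    then show ?thesis
      by cases (use identify(5,6) in \<open>simp_all del: mult_FactGroup one_FactGroup\<close>)
  qed
  show "carrier Q \<subseteq> word_eval Q w ` words (ab_gens k n g)"
  proof
    fix q assume "q \<in> carrier Q"
    then obtain a where a: "a \<in> carrier G" "q = r a"
      by (auto simp: carrier_FactGroup Gamma2_proj_def)
    then obtain u where u: "u \<in> words (braid_gens k n g)" "a = word_eval G v u"
      using pres unfolding has_presentation_def by (metis imageE)
    then have "q = word_eval Q (r \<circ> v) u"
      using a word_eval_hom[OF Q.is_group r_hom v_closed] by simp
    then show "q \<in> word_eval Q w ` words (ab_gens k n g)"
      using word_over_ab_gens[OF u(1)] by (metis imageI)
  qed
  fix u x assume u: "u \<in> words (ab_gens k n g)" "word_eval Q w u = \<one>\<^bsub>Q\<^esub>"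
    and x: "x \<in> ab_gens k n g"
  \<comment> \<open>Independence is tested in \<open>G\<close>: \<open>?u\<close> lifts
    \<open>u\<close> to a braid word, and \<open>weight ?F\<close> counts letters of class
    \<open>x\<close> with sign.\<close>
  let ?u = "map (map_prod ab_rep id) u" and ?F = "\<lambda>y. of_bool (ab_class y = x)"
  have u': "?u \<in> words (braid_gens k n g)"
    using u(1) by (induction u) (auto intro: ab_rep_in_braid_gens[OF n])
  have a: "word_eval G v ?u \<in> carrier G"
    by (rule word_eval_closed[OF v_closed u'])
  have "r (word_eval G v ?u) = word_eval Q w u"
    using word_eval_hom[OF Q.is_group r_hom v_closed u'] by (simp add: word_eval_map)
  \<comment> \<open>A trivial coset puts the lift into the commutator subgroup, where
    \<open>weight_dvd_if_derived\<close> applies.\<close>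
  then have "derived G (carrier G) #> word_eval G v ?u = derived G (carrier G)"
    using u(2) by (simp add: Gamma2_proj_def Gamma2_def)
  then have "word_eval G v ?u \<in> derived G (carrier G)"
    using coset_join1 a derived_is_subgroup[OF subset_refl] by blast
  then have "int (if x \<in> ab_squares k n g then 2 else 0) dvd weight ?F ?u"
    using weight_dvd_if_derived[OF pres braid_rels_exponent_sum[OF x] u'] by blast
  \<comment> \<open>As \<open>ab_class\<close> undoes \<open>ab_rep\<close>, the weight of the lift
    is the exponent sum of \<open>x\<close> in \<open>u\<close>.\<close>
  then show "int (if x \<in> ab_squares k n g then 2 else 0) dvd exponent_sum x u"
    by (simp add: weight_map comp_def)
qed

text \<open>The identity is inserted because for \<open>g \<ge> 1\<close> the letters
  \<open>LZeta i\<close> map to it.\<close>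

lemma generating_sets:
  "insert \<one>\<^bsub>Q\<^esub> (r ` v ` braid_gens k n g) = insert \<one>\<^bsub>Q\<^esub> (w ` ab_gens k n g)"
proof (intro equalityI insert_subsetI subsetI)
  fix q assume "q \<in> r ` v ` braid_gens k n g"
  then obtain y where "y \<in> braid_gens k n g" "q = (r \<circ> v) y"
    by auto
  then show "q \<in> insert \<one>\<^bsub>Q\<^esub> (w ` ab_gens k n g)"
    using rv_eq[of y] by (metis image_eqI insertCI)
next
  fix q assume "q \<in> w ` ab_gens k n g"
  then show "q \<in> insert \<one>\<^bsub>Q\<^esub> (r ` v ` braid_gens k n g)"
    using ab_rep_in_braid_gens[OF n] by auto
qed auto

lemma image_eq_singleton:
  assumes "A \<noteq> {}" "A \<subseteq> braid_gens k n g" "x \<in> ab_gens k n g" "\<And>y. y \<in> A \<Longrightarrow> ab_class y = x"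
  shows "r ` v ` A = {w x}"
proof -
  have "(r \<circ> v) y = w x" if "y \<in> A" for y
    using rv_eq[of y] assms(2-4) that by auto
  then show ?thesis
    using assms(1) by fastforce
qed

end

section \<open>Ranks of the free part and of the order two part\<close>

lemma finite_Shat: "finite (Shat k n)"
  by (simp add: Shat_def)

lemma finite_ab_gens: "finite (ab_gens k n g)"
  by (simp add: ab_gens_def finite_Shat Zhat_def)

lemma product_group_iso_power:
  assumes "finite I" "\<And>i. i \<in> I \<Longrightarrow> G i = H"
  shows "product_group I G \<cong> product_group {..<card I} (\<lambda>_. H)"
proof -
  obtain b where "bij_betw b {..<card I} I"
    using ex_bij_betw_nat_finite[OF assms(1)] by (auto simp: atLeast0LessThan)
  then show ?thesis
    using assms(2) by (intro product_group_reindex) (auto simp: bij_betw_def)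
qed

text \<open>Split the index set into \<open>X - S\<close> and \<open>S\<close>; the group
  \<open>integer_mod_group 0\<close> is \<open>integer_group\<close> by definition.\<close>

lemma iso_Z_power_Z2_power:
  assumes "finite X" "S \<subseteq> X"
  shows "product_group X (\<lambda>x. integer_mod_group (if x \<in> S then 2 else 0)) \<cong>
    Z_power (card (X - S)) \<times>\<times> Z2_power (card S)"
proof -
  let ?P = "\<lambda>I. product_group I (\<lambda>x. integer_mod_group (if x \<in> S then 2 else 0))"
  have fin: "finite (X - S)" "finite S"
    using assms finite_subset by auto
  have "?P (X - S) \<cong> Z_power (card (X - S))"
    unfolding Z_power_def
    by (rule product_group_iso_power[OF fin(1)]) (simp add: integer_mod_group_def)
  moreover have "?P S \<cong> Z2_power (card S)"
    unfolding Z2_power_def by (rule product_group_iso_power[OF fin(2)]) simp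
  moreover have "group (?P (X - S))"
    by (rule product_group) simp
  ultimately have "?P (X - S) \<times>\<times> ?P S \<cong> Z_power (card (X - S)) \<times>\<times> Z2_power (card S)"
    by (intro group.DirProd_iso_trans)
  moreover have "?P ((X - S) \<union> S) \<cong> ?P (X - S) \<times>\<times> ?P S"
    by (rule product_group_Un_disjoint) auto
  ultimately have "?P ((X - S) \<union> S) \<cong> Z_power (card (X - S)) \<times>\<times> Z2_power (card S)"
    by (rule iso_trans[rotated])
  then show ?thesis
    using assms(2) by (simp add: Un_absorb2)
qed

lemma card_free_ab_gens: "card (ab_gens k n g - Shat k n) = (if g = 0 then 1 else 4 * g)"
proof -
  \<comment> \<open>The union is nested to the right so that disjoint pieces can be split off one at
    a time.\<close>
  have "ab_gens k n g - Shat k n = Zhat g \<union> (QA ` {1..g} \<union> (QB ` {1..g} \<union> (QAt ` {1..g} \<union> QBt ` {1..g})))"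
    by (auto simp: ab_gens_def Shat_def Zhat_def)
  also have "card \<dots> = card (Zhat g) + (g + (g + (g + g)))"
    by (subst card_Un_disjoint; (auto simp: Zhat_def card_image inj_on_def)?)+
  finally show ?thesis
    by (simp add: Zhat_def)
qed

lemma card_ab_gens_0: "card (ab_gens k n 0) = card (Shat k n) + 1"
proof -
  have "ab_gens k n 0 = Shat k n \<union> {QZeta}" "QZeta \<notin> Shat k n"
    by (auto simp: ab_gens_def Zhat_def Shat_def)
  then show ?thesis
    by (simp add: finite_Shat)
qed

theorem proposition3p3:
  fixes \<Sigma> :: "'a topology" and x0 :: "(nat \<Rightarrow> 'a) set" and k n g :: nat
    and v :: "braid_letter \<Rightarrow> (real \<Rightarrow> (nat \<Rightarrow> 'a) set) set"
  assumes "n \<ge> 1" and "k \<ge> 1"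
    and "one_holed_surface g \<Sigma>"
    and "x0 \<in> topspace (mixed_config_space \<Sigma> k n)"
    and "has_presentation (mixed_braid_group \<Sigma> k n x0) (braid_gens k n g) (braid_rels k n g) v"
  shows "let G = mixed_braid_group \<Sigma> k n x0; Q = G Mod Gamma2 G; r = Gamma2_proj G in
    (\<exists>w. has_presentation Q (ab_gens k n g) (ab_rels k n g) w \<and>
         (\<forall>i\<in>{1..g}. w (QA i) = r (v (LA i)) \<and> w (QB i) = r (v (LB i)) \<and>
                      w (QAt i) = r (v (LAt i)) \<and> w (QBt i) = r (v (LBt i))) \<and>
         insert \<one>\<^bsub>Q\<^esub> (r ` v ` braid_gens k n g) = insert \<one>\<^bsub>Q\<^esub> (w ` ab_gens k n g) \<and>
         (k \<ge> 2 \<longrightarrow> r ` v ` S_letters k = {w QSigma}) \<and>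
         (n \<ge> 2 \<longrightarrow> r ` v ` St_letters n = {w QSigmat}) \<and>
         (g = 0 \<longrightarrow> r ` v ` Z_letters n = {w QZeta})) \<and>
    (g = 0 \<longrightarrow> Q \<cong> Z_power (card (Shat k n) + 1)) \<and>
    (g \<ge> 1 \<longrightarrow> Q \<cong> Z_power (4 * g) \<times>\<times> Z2_power (card (Shat k n)))"
proof -
  let ?G = "mixed_braid_group \<Sigma> k n x0"
  have "group ?G"
    using assms(5) by (simp add: has_presentation_def)
  then interpret mixed_braid_presentation ?G k n g v
    using assms by (simp add: mixed_braid_presentation_def mixed_braid_presentation_axioms_def)
  have "has_presentation Q (ab_gens k n g) (ab_rels k n g) w"
    unfolding ab_rels_eq by (rule ab.has_presentation_basis)
  have "\<forall>i\<in>{1..g}. w (QA i) = r (v (LA i)) \<and> w (QB i) = r (v (LB i)) \<and>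
      w (QAt i) = r (v (LAt i)) \<and> w (QBt i) = r (v (LBt i))"
    by simp
  have "k \<ge> 2 \<longrightarrow> r ` v ` S_letters k = {w QSigma}"
    by (intro impI image_eq_singleton) (auto simp: S_letters_def)
  have "n \<ge> 2 \<longrightarrow> r ` v ` St_letters n = {w QSigmat}"
    by (intro impI image_eq_singleton) (auto simp: St_letters_def)
  have "g = 0 \<longrightarrow> r ` v ` Z_letters n = {w QZeta}"
    using n by (intro impI image_eq_singleton) (auto simp: Z_letters_def)
  have "g = 0 \<longrightarrow> Q \<cong> Z_power (card (Shat k n) + 1)"
  proof
    assume "g = 0"
    \<comment> \<open>In genus 0 no letter is an involution, so all moduli are 0 and every generator
      contributes a free factor.\<close>
    have "product_group (ab_gens k n g) (\<lambda>x. integer_mod_group (if x \<in> ab_squares k n g then 2 else 0))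
        \<cong> Z_power (card (ab_gens k n g))"
      unfolding Z_power_def
      by (rule product_group_iso_power[OF finite_ab_gens])
        (simp add: \<open>g = 0\<close> ab_squares_def integer_mod_group_def)
    from iso_trans[OF ab.iso_product_group_basis[OF finite_ab_gens] this]
    show "Q \<cong> Z_power (card (Shat k n) + 1)"
      by (simp only: \<open>g = 0\<close> card_ab_gens_0)
  qed
  have "g \<ge> 1 \<longrightarrow> Q \<cong> Z_power (4 * g) \<times>\<times> Z2_power (card (Shat k n))"
  proof
    assume "g \<ge> 1"
    \<comment> \<open>In positive genus the involutions are exactly \<open>Shat k n\<close>, and the
      remaining letters are the four handle families.\<close>
    have "ab_squares k n g = Shat k n" "card (ab_gens k n g - Shat k n) = 4 * g"
      using \<open>g \<ge> 1\<close> by (simp_all add: ab_squares_def card_free_ab_gens)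
    with iso_trans[OF ab.iso_product_group_basis[OF finite_ab_gens]
        iso_Z_power_Z2_power[OF finite_ab_gens ab_squares_subset]]
    show "Q \<cong> Z_power (4 * g) \<times>\<times> Z2_power (card (Shat k n))"
      by simp
  qed
  show ?thesis
    unfolding Let_def by (intro conjI exI[of _ w]; (fact | fact generating_sets))
qed

end
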